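(* Let $\mathbb{P}=(R,G)$ be a partial field, and let $X,Y,X_1,Y_1,X_2,Y_2$ be pairwise disjoint finite sets. Suppose $A_1$ is an $(X_1\cup X)\times(Y_1\cup Y)$ $\mathbb{P}$-matrix and $A_2$ is an $(X\cup X_2)\times(Y\cup Y_2)$ $\mathbb{P}$-matrix of the block forms $$A_1=\begin{pmatrix} D_1' & 0\\ D_1 & D_X\end{pmatrix},\qquad A_2=\begin{pmatrix} D_X & D_2\\ 0 & D_2'\end{pmatrix},$$ where in $A_1$ the rows are indexed by $X_1$ (top) and $X$ (bottom) and the columns by $Y_1$ (left) and $Y$ (right), and in $A_2$ the rows are indexed by $X$ (top) and $X_2$ (bottom) and the columns by $Y$ (left) and $Y_2$ (right); in particular the $X\times Y$ block $D_X$ is the same in both. Let $M_1=M[I\ A_1]$ and $M_2=M[I\ A_2]$, and suppose $X\cup Y$ is a modular flat of $M_1$. Then the $(X_1\cup X\cup X_2)\times(Y_1\cup Y\cup Y_2)$ matrix $$A=\begin{pmatrix} D_1' & 0 & 0\\ D_1 & D_X & D_2\\ 0 & 0 & D_2'\end{pmatrix}$$ (rows indexed by $X_1,X,X_2$ and columns by $Y_1,Y,Y_2$, in that order) is a $\mathbb{P}$-matrix, and $M[I\ A]=P_N(M_1,M_2)$, where $N=M[I\ D_X]$.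
   Context: A partial field is a pair $\mathbb{P}=(R,G)$ where $R$ is a commutative ring with identity and $G$ is a subgroup of the group of units of $R$ with $-1\in G$. A matrix $A$ with entries in $R$ is a $\mathbb{P}$-matrix if every square submatrix of $A$ has determinant either $0$ or in $G$. Matrices have rows and columns labelled by finite sets. If $A$ is an $X\times Y$ $\mathbb{P}$-matrix with $X\cap Y=\emptyset$, then $[I\ A]$ denotes the $X\times(X\cup Y)$ matrix obtained by prepending the identity matrix $I_X$, and $M[I\ A]$ denotes the matroid on $X\cup Y$ whose bases are the sets $B\subseteq X\cup Y$ with $|B|=|X|$ and $\det([I\ A][X,B])\neq 0$. For matroids $M_1,M_2$ with $E(M_1)\cap E(M_2)=T$, $M_1|T=M_2|T=N$ and $T$ a modular flat of $M_1$, $P_N(M_1,M_2)$ denotes Brylawski's generalized parallel connection of $M_1$ and $M_2$ along $N$. *)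

theory Defs
  imports
    "Jordan_Normal_Form.Determinant"
    "HOL-Combinatorics.List_Permutation"
begin

section \<open>Matrices with labelled rows and columns\<close>

text \<open>
  A matrix with rows labelled by \<open>X\<close> and columns labelled by \<open>Y\<close> is a function of a row label and a
  column label; its values outside \<open>X \<times> Y\<close> are irrelevant.
\<close>

type_synonym ('a, 'r) lmatrix = "'a \<Rightarrow> 'a \<Rightarrow> 'r"

definition list_submatrix :: "('a, 'r) lmatrix \<Rightarrow> 'a list \<Rightarrow> 'a list \<Rightarrow> 'r mat" where
  "list_submatrix A xs ys = mat (length xs) (length ys) (\<lambda>(i, j). A (xs ! i) (ys ! j))"

definition enum_of :: "'a set \<Rightarrow> 'a list" where
  "enum_of S = (SOME xs. distinct xs \<and> set xs = S)"

text \<open>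
  The determinant of \<open>A[S, T]\<close> for finite \<open>S\<close>, \<open>T\<close> with \<open>card S = card T\<close>. Labels are unordered, so it
  is only meaningful up to sign; \<open>sub_det_sign\<close> below shows that the chosen enumerations do not matter
  beyond that.
\<close>

definition sub_det :: "('a, 'r::comm_ring_1) lmatrix \<Rightarrow> 'a set \<Rightarrow> 'a set \<Rightarrow> 'r" where
  "sub_det A S T = det (list_submatrix A (enum_of S) (enum_of T))"

definition row_split :: "'a set \<Rightarrow> ('a, 'r) lmatrix \<Rightarrow> ('a, 'r) lmatrix \<Rightarrow> ('a, 'r) lmatrix" where
  "row_split S A B = (\<lambda>x y. if x \<in> S then A x y else B x y)"

definition col_split :: "'a set \<Rightarrow> ('a, 'r) lmatrix \<Rightarrow> ('a, 'r) lmatrix \<Rightarrow> ('a, 'r) lmatrix" where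
  "col_split S A B = (\<lambda>x y. if y \<in> S then A x y else B x y)"

definition zero_lmat :: "('a, 'r::zero) lmatrix" where
  "zero_lmat = (\<lambda>x y. 0)"

definition prepend_identity :: "'a set \<Rightarrow> ('a, 'r::comm_ring_1) lmatrix \<Rightarrow> ('a, 'r) lmatrix" where
  "prepend_identity X A = col_split X (\<lambda>x y. if x = y then 1 else 0) A"


section \<open>Partial fields\<close>

text \<open>The ring of the partial field is the type \<open>'r\<close>, so only the group \<open>G\<close> is a parameter.\<close>

definition partial_field :: "'r::comm_ring_1 set \<Rightarrow> bool" where
  "partial_field G \<longleftrightarrow>
     1 \<in> G \<and> (\<forall>g\<in>G. \<forall>h\<in>G. g * h \<in> G) \<and> (\<forall>g\<in>G. \<exists>h\<in>G. g * h = 1) \<and> - 1 \<in> G"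

definition P_matrix :: "'r::comm_ring_1 set \<Rightarrow> 'a set \<Rightarrow> 'a set \<Rightarrow> ('a, 'r) lmatrix \<Rightarrow> bool" where
  "P_matrix G X Y A \<longleftrightarrow>
     (\<forall>S T. S \<subseteq> X \<and> T \<subseteq> Y \<and> card S = card T \<longrightarrow> sub_det A S T = 0 \<or> sub_det A S T \<in> G)"


section \<open>Matroids\<close>

record 'a set_system =
  ground :: "'a set"
  bases :: "'a set set"

definition matroid :: "'a set_system \<Rightarrow> bool" where
  "matroid M \<longleftrightarrow>
     finite (ground M) \<and> bases M \<subseteq> Pow (ground M) \<and> bases M \<noteq> {} \<and>
     (\<forall>B\<in>bases M. \<forall>B'\<in>bases M. \<forall>x\<in>B - B'. \<exists>y\<in>B' - B. insert y (B - {x}) \<in> bases M)"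

definition indep :: "'a set_system \<Rightarrow> 'a set \<Rightarrow> bool" where
  "indep M I \<longleftrightarrow> (\<exists>B\<in>bases M. I \<subseteq> B)"

definition restriction :: "'a set_system \<Rightarrow> 'a set \<Rightarrow> 'a set_system" where
  "restriction M T =
     \<lparr>ground = T,
      bases = {B. B \<subseteq> T \<and> indep M B \<and> (\<forall>I. indep M I \<and> B \<subseteq> I \<and> I \<subseteq> T \<longrightarrow> I = B)}\<rparr>"

definition rank :: "'a set_system \<Rightarrow> 'a set \<Rightarrow> nat" where
  "rank M S = Max {card I |I. I \<subseteq> S \<and> indep M I}"

definition closure :: "'a set_system \<Rightarrow> 'a set \<Rightarrow> 'a set" where
  "closure M S = {e \<in> ground M. rank M (insert e S) = rank M S}"

definition flat :: "'a set_system \<Rightarrow> 'a set \<Rightarrow> bool" where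
  "flat M F \<longleftrightarrow> F \<subseteq> ground M \<and> closure M F = F"

definition modular_flat :: "'a set_system \<Rightarrow> 'a set \<Rightarrow> bool" where
  "modular_flat M T \<longleftrightarrow>
     flat M T \<and> (\<forall>F. flat M F \<longrightarrow> rank M T + rank M F = rank M (T \<union> F) + rank M (T \<inter> F))"

definition gpc_admissible :: "'a set_system \<Rightarrow> 'a set_system \<Rightarrow> 'a set_system \<Rightarrow> bool" where
  "gpc_admissible N M1 M2 \<longleftrightarrow>
     matroid M1 \<and> matroid M2 \<and>
     restriction M1 (ground M1 \<inter> ground M2) = N \<and>
     restriction M2 (ground M1 \<inter> ground M2) = N \<and>
     modular_flat M1 (ground M1 \<inter> ground M2)"

text \<open>
  Brylawski's generalized parallel connection \<open>P\<^sub>N(M\<^sub>1, M\<^sub>2)\<close>: the matroid on \<open>E(M\<^sub>1) \<union> E(M\<^sub>2)\<close> whose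
  flats are the sets meeting \<open>E(M\<^sub>i)\<close> in a flat of \<open>M\<^sub>i\<close> for \<open>i = 1, 2\<close>. A matroid is determined by its
  flats, so there is at most one. The value is unspecified if the data are not admissible.
\<close>

definition generalized_parallel_connection ::
    "'a set_system \<Rightarrow> 'a set_system \<Rightarrow> 'a set_system \<Rightarrow> 'a set_system" where
  "generalized_parallel_connection N M1 M2 =
     (THE M. gpc_admissible N M1 M2 \<and> matroid M \<and> ground M = ground M1 \<union> ground M2 \<and>
        (\<forall>F \<subseteq> ground M. flat M F \<longleftrightarrow> flat M1 (F \<inter> ground M1) \<and> flat M2 (F \<inter> ground M2)))"

text \<open>\<open>M[I A]\<close> for an \<open>X \<times> Y\<close> matrix \<open>A\<close>\<close>

definition matroid_of :: "'a set \<Rightarrow> 'a set \<Rightarrow> ('a, 'r::comm_ring_1) lmatrix \<Rightarrow> 'a set_system" where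
  "matroid_of X Y A =
     \<lparr>ground = X \<union> Y,
      bases = {B. B \<subseteq> X \<union> Y \<and> card B = card X \<and> sub_det (prepend_identity X A) X B \<noteq> 0}\<rparr>"


section \<open>Independence of the enumerations\<close>

lemma enum_of: "finite S \<Longrightarrow> distinct (enum_of S) \<and> set (enum_of S) = S"
  unfolding enum_of_def by (rule someI_ex) (use finite_distinct_list in blast)

lemma det_list_submatrix_rows:
  fixes A :: "('a, 'r::comm_ring_1) lmatrix"
  assumes "distinct xs" "distinct xs'" "set xs = set xs'" "length ys = length xs"
  shows "det (list_submatrix A xs' ys) = det (list_submatrix A xs ys)
       \<or> det (list_submatrix A xs' ys) = - det (list_submatrix A xs ys)"
proof -
  have "mset xs' = mset xs"
    using assms by (metis set_eq_iff_mset_eq_distinct)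
  then obtain p where p: "p permutes {..<length xs}" "permute_list p xs = xs'"
    by (rule mset_eq_permutation)
  let ?n = "length xs"
  have p': "p permutes {0..<?n}" using p(1) by (simp add: atLeast0LessThan)
  have nth: "xs' ! i = xs ! p i" if "i < ?n" for i
    using p that by (metis permute_list_nth)
  have len: "length xs' = ?n" using p(2) by auto
  have lt: "p i < ?n" if "i < ?n" for i
    using permutes_in_image[OF p(1)] that by auto
  have C: "list_submatrix A xs ys \<in> carrier_mat ?n ?n"
    by (simp add: list_submatrix_def assms(4))
  have "list_submatrix A xs' ys = mat ?n ?n (\<lambda>(i, j). list_submatrix A xs ys $$ (p i, j))"
    by (rule eq_matI) (auto simp: list_submatrix_def len nth lt assms(4))
  then have "det (list_submatrix A xs' ys) = signof p * det (list_submatrix A xs ys)"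
    using det_permute_rows[OF C p'] by simp
  then show ?thesis by (auto simp: sign_def)
qed

lemma det_list_submatrix_transpose:
  fixes A :: "('a, 'r::comm_ring_1) lmatrix"
  assumes "length ys = length xs"
  shows "det (list_submatrix (\<lambda>y x. A x y) ys xs) = det (list_submatrix A xs ys)"
proof -
  have "list_submatrix (\<lambda>y x. A x y) ys xs = transpose_mat (list_submatrix A xs ys)"
    by (rule eq_matI) (auto simp: list_submatrix_def)
  moreover have "list_submatrix A xs ys \<in> carrier_mat (length xs) (length xs)"
    by (simp add: list_submatrix_def assms)
  ultimately show ?thesis by (simp add: det_transpose)
qed

lemma sub_det_sign:
  fixes A :: "('a, 'r::comm_ring_1) lmatrix"
  assumes "distinct xs" "distinct ys" "length xs = length ys"
  shows "sub_det A (set xs) (set ys) = det (list_submatrix A xs ys)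
       \<or> sub_det A (set xs) (set ys) = - det (list_submatrix A xs ys)"
proof -
  let ?xs = "enum_of (set xs)" and ?ys = "enum_of (set ys)"
  have e: "distinct ?xs" "set ?xs = set xs" "distinct ?ys" "set ?ys = set ys"
    using enum_of by (metis List.finite_set)+
  have len: "length ?xs = length xs" "length ?ys = length ys"
    using e assms by (metis distinct_card)+
  have 1: "det (list_submatrix A ?xs ys) = det (list_submatrix A xs ys)
       \<or> det (list_submatrix A ?xs ys) = - det (list_submatrix A xs ys)"
    by (rule det_list_submatrix_rows) (use e assms in auto)
  have "det (list_submatrix (\<lambda>y x. A x y) ?ys ?xs) = det (list_submatrix (\<lambda>y x. A x y) ys ?xs)
      \<or> det (list_submatrix (\<lambda>y x. A x y) ?ys ?xs) = - det (list_submatrix (\<lambda>y x. A x y) ys ?xs)"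
    by (rule det_list_submatrix_rows) (use e len assms in auto)
  then have "det (list_submatrix A ?xs ?ys) = det (list_submatrix A ?xs ys)
      \<or> det (list_submatrix A ?xs ?ys) = - det (list_submatrix A ?xs ys)"
    using det_list_submatrix_transpose[of ?ys ?xs A] det_list_submatrix_transpose[of ys ?xs A]
      len assms by simp
  with 1 show ?thesis unfolding sub_det_def by auto
qed

end

theory Submission
  imports Defs
begin

text \<open>
  A matrix \<open>A\<close> is a \<open>P\<close>-matrix iff every maximal minor of \<open>[I A]\<close> is \<open>0\<close> or in \<open>G\<close>. Let \<open>B\<close> be a set of
  columns of \<open>[I A]\<close> of the right size and \<open>Q\<close> the part of \<open>B\<close> outside \<open>E(M\<^sub>2)\<close>. If \<open>|Q| \<le> |X\<^sub>1|\<close>, the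
  minor at \<open>B\<close> is block triangular, hence \<open>0\<close> or a product of a minor of \<open>[I A\<^sub>1]\<close> and one of
  \<open>[I A\<^sub>2]\<close>. If \<open>|Q| > |X\<^sub>1|\<close>, either \<open>Q\<close> is dependent in \<open>M\<^sub>1\<close> and the minor vanishes, or modularity of
  \<open>T = X \<union> Y\<close> gives a nonzero column \<open>e \<in> T\<close> in the closure of \<open>Q\<close>. By Cramer's rule \<open>e\<close> is a combination of \<open>Q\<close>
  with coefficients in \<open>G \<union> {0}\<close>, so exchanging a suitable element of \<open>Q\<close> for \<open>e\<close> changes the minor by a factor
  in \<open>G\<close>, and induction on \<open>|Q|\<close> applies.

  For the identification of the matroid, the zero blocks of \<open>A\<close> show that \<open>M[I A]\<close> restricts to \<open>M\<^sub>i\<close> on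
  \<open>E(M\<^sub>i)\<close> and that \<open>r(E\<^sub>1 \<union> E\<^sub>2) + r(T) = r(E\<^sub>1) + r(E\<^sub>2)\<close>. With \<open>T\<close> a modular flat of \<open>M\<^sub>1\<close>,
  submodularity alone then forces the flats to be those of the generalized parallel connection.
\<close>

section \<open>Bases, rank and flats of matroids\<close>

lemma matroid_finite: "matroid M \<Longrightarrow> finite (ground M)"
  and bases_subset: "matroid M \<Longrightarrow> B \<in> bases M \<Longrightarrow> B \<subseteq> ground M"
  and bases_nonempty: "matroid M \<Longrightarrow> bases M \<noteq> {}"
  by (auto simp: matroid_def)

lemma bases_finite: "matroid M \<Longrightarrow> B \<in> bases M \<Longrightarrow> finite B"
  by (rule finite_subset[OF bases_subset matroid_finite])

lemma basis_exchange:
  assumes "matroid M" "B \<in> bases M" "B' \<in> bases M" "x \<in> B - B'"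
  obtains y where "y \<in> B' - B" "insert y (B - {x}) \<in> bases M"
  using assms unfolding matroid_def by meson

text \<open>Each exchange moves \<open>B\<close> one step towards \<open>C\<close> at constant size.
  Induction on \<open>card (B - C)\<close> ends with \<open>B \<subseteq> C\<close>, where an
  element of \<open>C - B\<close> would have no partner for an exchange.\<close>

lemma card_bases_eq:
  assumes M: "matroid M" and B: "B \<in> bases M" and C: "C \<in> bases M"
  shows "card B = card C"
  using B
proof (induction "card (B - C)" arbitrary: B rule: less_induct)
  case less
  have fin: "finite B" "finite C"
    using M less.prems C by (auto intro: bases_finite)
  show ?case
  proof (cases "B \<subseteq> C")
    case True
    have "C \<subseteq> B"
    proof
      fix x assume "x \<in> C"
      show "x \<in> B"
      proof (rule ccontr)
        assume "x \<notin> B"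
        with \<open>x \<in> C\<close> have "x \<in> C - B" by simp
        then obtain y where "y \<in> B - C" by (rule basis_exchange[OF M C less.prems])
        then show False using True by blast
      qed
    qed
    with True show ?thesis by simp
  next
    case False
    then obtain x where x: "x \<in> B - C" by blast
    obtain y where y: "y \<in> C - B" "insert y (B - {x}) \<in> bases M"
      by (rule basis_exchange[OF M less.prems C x])
    have "insert y (B - {x}) - C \<subseteq> B - C - {x}" using y by auto
    then have "insert y (B - {x}) - C \<subset> B - C" using x by auto
    then have "card (insert y (B - {x}) - C) < card (B - C)"
      using fin by (simp add: psubset_card_mono)
    then have "card (insert y (B - {x})) = card C" using less.hyps y by blast
    moreover have "card (insert y (B - {x})) = card B"
      using x y fin card_Suc_Diff1[of B x] by simp
    ultimately show ?thesis by simp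
  qed
qed

section \<open>Independent sets and rank\<close>

lemma indep_subset: "indep M I \<Longrightarrow> J \<subseteq> I \<Longrightarrow> indep M J"
  unfolding indep_def by blast

lemma indep_ground: "matroid M \<Longrightarrow> indep M I \<Longrightarrow> I \<subseteq> ground M"
  unfolding indep_def using bases_subset by blast

lemma indep_finite: "matroid M \<Longrightarrow> indep M I \<Longrightarrow> finite I"
  by (rule finite_subset[OF indep_ground matroid_finite])

lemma indep_empty: "matroid M \<Longrightarrow> indep M {}"
  unfolding indep_def using bases_nonempty by blast

lemma indep_basis: "B \<in> bases M \<Longrightarrow> indep M B"
  unfolding indep_def by blast

text \<open>Let \<open>C\<close> be a basis containing \<open>J\<close>. A basis through
  \<open>I\<close> that meets \<open>C\<close> in as many elements as possible stays inside
  \<open>I \<union> C\<close>, and counting then forces it to contain an element of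
  \<open>J - I\<close>.\<close>

lemma indep_augment:
  assumes M: "matroid M" and I: "indep M I" and J: "indep M J" and less: "card I < card J"
  shows "\<exists>e\<in>J - I. indep M (insert e I)"
proof -
  obtain C where C: "C \<in> bases M" "J \<subseteq> C" using J unfolding indep_def by blast
  have finC: "finite C" using bases_finite[OF M] C by blast
  obtain B where B: "B \<in> bases M" "I \<subseteq> B"
    and max: "\<And>B'. B' \<in> bases M \<Longrightarrow> I \<subseteq> B' \<Longrightarrow> card (B' \<inter> C) \<le> card (B \<inter> C)"
  proof -
    let ?P = "\<lambda>B. B \<in> bases M \<and> I \<subseteq> B"
    obtain B0 where "?P B0" using I unfolding indep_def by auto
    moreover have "\<forall>B. ?P B \<longrightarrow> card (B \<inter> C) < Suc (card C)"
      using finC by (simp add: card_mono le_imp_less_Suc)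
    ultimately have "\<exists>B. ?P B \<and> (\<forall>B'. ?P B' \<longrightarrow> card (B' \<inter> C) \<le> card (B \<inter> C))"
      using ex_has_greatest_nat[of ?P B0 "\<lambda>B. card (B \<inter> C)" "Suc (card C)"] by simp
    then show ?thesis using that by auto
  qed
  have finB: "finite B" using bases_finite[OF M] B by blast
  have BC: "B \<subseteq> I \<union> C"
  proof (rule ccontr)
    assume "\<not> B \<subseteq> I \<union> C"
    then obtain x where x: "x \<in> B" "x \<notin> I" "x \<notin> C" by blast
    have "x \<in> B - C" using x by simp
    then obtain y where y: "y \<in> C - B" "insert y (B - {x}) \<in> bases M"
      by (rule basis_exchange[OF M B(1) C(1)])
    have "I \<subseteq> insert y (B - {x})" using B x by blast
    then have "card (insert y (B - {x}) \<inter> C) \<le> card (B \<inter> C)" using max y by blast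
    moreover have "insert y (B - {x}) \<inter> C = insert y (B \<inter> C)" using x y by blast
    moreover have "card (insert y (B \<inter> C)) = Suc (card (B \<inter> C))" using y finC by simp
    ultimately show False by simp
  qed
  \<comment> \<open>Otherwise \<open>B\<close> would lie in \<open>I \<union> (C - J)\<close>, which
    is smaller than \<open>C\<close>, although all bases have the same size.\<close>
  have "\<not> B \<inter> J \<subseteq> I"
  proof
    assume "B \<inter> J \<subseteq> I"
    then have "B \<subseteq> I \<union> (C - J)" using BC by blast
    then have "card B \<le> card I + card (C - J)"
      by (meson card_Un_le card_mono finC finB B finite_Diff finite_UnI finite_subset le_trans)
    also have "\<dots> < card J + card (C - J)" using less by simp
    also have "\<dots> = card C"
      using C finC by (metis card_Diff_subset card_mono finite_subset le_add_diff_inverse)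
    finally show False using card_bases_eq[OF M B(1) C(1)] by simp
  qed
  then obtain e where e: "e \<in> B" "e \<in> J" "e \<notin> I" by blast
  then have "insert e I \<subseteq> B" using B by blast
  then show ?thesis using e B unfolding indep_def by blast
qed

text \<open>\<open>Max\<close> in the definition of \<open>rank\<close> is only meaningful for a
  finite nonempty set.\<close>

lemma rank_set:
  assumes "matroid M"
  shows "finite {card I |I. I \<subseteq> S \<and> indep M I}" "{card I |I. I \<subseteq> S \<and> indep M I} \<noteq> {}"
proof -
  have "{card I |I. I \<subseteq> S \<and> indep M I} \<subseteq> card ` Pow (ground M)"
    using indep_ground[OF assms] by blast
  moreover have "finite (Pow (ground M))" using matroid_finite[OF assms] by simp
  ultimately show "finite {card I |I. I \<subseteq> S \<and> indep M I}" by (meson finite_imageI finite_subset)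
  show "{card I |I. I \<subseteq> S \<and> indep M I} \<noteq> {}" using indep_empty[OF assms] by blast
qed

lemma card_le_rank: "matroid M \<Longrightarrow> indep M I \<Longrightarrow> I \<subseteq> S \<Longrightarrow> card I \<le> rank M S"
  unfolding rank_def by (rule Max_ge) (use rank_set in blast)+

lemma rank_witness:
  assumes "matroid M" obtains I where "I \<subseteq> S" "indep M I" "card I = rank M S"
proof -
  have "rank M S \<in> {card I |I. I \<subseteq> S \<and> indep M I}"
    unfolding rank_def by (rule Max_in) (use rank_set[OF assms] in blast)+
  then show ?thesis using that by force
qed

lemma rank_indep:
  assumes "matroid M" "indep M I" shows "rank M I = card I"
proof -
  obtain J where J: "J \<subseteq> I" "indep M J" "card J = rank M I" by (rule rank_witness[OF assms(1)])
  then have "rank M I \<le> card I" using indep_finite[OF assms] card_mono by metis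
  then show ?thesis using card_le_rank[OF assms] by (simp add: order_antisym)
qed

lemma rank_mono:
  assumes "matroid M" "S \<subseteq> T" shows "rank M S \<le> rank M T"
  using assms by (metis card_le_rank order_trans rank_witness)

lemma indep_extend:
  assumes M: "matroid M" and "indep M I" "I \<subseteq> S"
  obtains J where "I \<subseteq> J" "J \<subseteq> S" "indep M J" "card J = rank M S"
proof -
  have "\<exists>J. I \<subseteq> J \<and> J \<subseteq> S \<and> indep M J \<and> card J = rank M S" using assms(2,3)
  proof (induction "rank M S - card I" arbitrary: I)
    case 0
    then have "card I = rank M S" using card_le_rank[OF M] by (simp add: order_antisym)
    then show ?case using 0 by blast
  next
    case (Suc n)
    obtain K where K: "K \<subseteq> S" "indep M K" "card K = rank M S" by (rule rank_witness[OF M])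
    then obtain e where e: "e \<in> K - I" "indep M (insert e I)"
      using indep_augment[OF M Suc.prems(1) K(2)] Suc.hyps(2) by force
    then have "card (insert e I) = Suc (card I)" using indep_finite[OF M Suc.prems(1)] by simp
    then have "n = rank M S - card (insert e I)" using Suc.hyps(2) by simp
    then obtain J where "insert e I \<subseteq> J" "J \<subseteq> S" "indep M J" "card J = rank M S"
      using Suc.hyps(1) e K Suc.prems by blast
    then show ?case by blast
  qed
  then show ?thesis using that by blast
qed

text \<open>A maximum independent set \<open>I\<close> of \<open>S \<inter> T\<close> is extended to
  a maximum one \<open>J\<close> of \<open>S \<union> T\<close>. The parts of \<open>J\<close> in
  \<open>S\<close> and in \<open>T\<close> are independent, cover \<open>J\<close> and overlap at
  least in \<open>I\<close>.\<close>

lemma rank_submodular: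
  assumes M: "matroid M"
  shows "rank M (S \<union> T) + rank M (S \<inter> T) \<le> rank M S + rank M T"
proof -
  obtain I where I: "I \<subseteq> S \<inter> T" "indep M I" "card I = rank M (S \<inter> T)"
    by (rule rank_witness[OF M])
  then obtain J where J: "I \<subseteq> J" "J \<subseteq> S \<union> T" "indep M J" "card J = rank M (S \<union> T)"
    using indep_extend[OF M, of I "S \<union> T"] by blast
  have fin: "finite J" by (rule indep_finite[OF M J(3)])
  have "card J + card I \<le> card (J \<inter> S \<union> J \<inter> T) + card (J \<inter> S \<inter> (J \<inter> T))"
  proof (intro add_mono)
    have "J = J \<inter> S \<union> J \<inter> T" using J(2) by auto
    then show "card J \<le> card (J \<inter> S \<union> J \<inter> T)" by simp
    show "card I \<le> card (J \<inter> S \<inter> (J \<inter> T))" by (rule card_mono) (use I(1) J(1) fin in auto)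
  qed
  also have "\<dots> = card (J \<inter> S) + card (J \<inter> T)" using fin by (intro card_Un_Int[symmetric]) auto
  also have "\<dots> \<le> rank M S + rank M T"
    by (intro add_mono card_le_rank[OF M] indep_subset[OF J(3)]) auto
  finally show ?thesis using I J by simp
qed

text \<open>Submodularity merged with monotonicity, so that later applications only have to check
  inclusions.\<close>

lemma rank_submodular_le:
  assumes "matroid M" "U \<subseteq> S \<union> T" "V \<subseteq> S \<inter> T"
  shows "rank M U + rank M V \<le> rank M S + rank M T"
  using rank_submodular[OF assms(1), of S T] rank_mono[OF assms(1,2)] rank_mono[OF assms(1,3)]
  by linarith

section \<open>Closure and flats\<close>

lemma closure_subset: "closure M S \<subseteq> ground M"
  unfolding closure_def by blast

lemma subset_closure: "S \<subseteq> ground M \<Longrightarrow> S \<subseteq> closure M S"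
  unfolding closure_def by (auto simp: insert_absorb)

text \<open>By submodularity, an element that does not raise the rank of \<open>S\<close> cannot
  raise the rank of a larger set.\<close>

lemma closure_mono:
  assumes M: "matroid M" and "S \<subseteq> T"
  shows "closure M S \<subseteq> closure M T"
proof
  fix e assume e: "e \<in> closure M S"
  have "rank M (insert e T) + rank M S \<le> rank M (insert e S) + rank M T"
    by (rule rank_submodular_le[OF M]) (use assms(2) in auto)
  moreover have "rank M T \<le> rank M (insert e T)" by (rule rank_mono[OF M]) blast
  ultimately show "e \<in> closure M T" using e unfolding closure_def by simp
qed

text \<open>A larger independent set in the closure would augment a maximum independent subset of
  \<open>S\<close> by some \<open>e\<close> in the closure, contradicting that \<open>e\<close> does
  not raise the rank of \<open>S\<close>.\<close>

lemma rank_closure: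
  assumes M: "matroid M" and S: "S \<subseteq> ground M"
  shows "rank M (closure M S) = rank M S"
proof (rule antisym)
  show "rank M S \<le> rank M (closure M S)" by (rule rank_mono[OF M subset_closure[OF S]])
  show "rank M (closure M S) \<le> rank M S"
  proof (rule ccontr)
    assume less: "\<not> rank M (closure M S) \<le> rank M S"
    obtain I where I: "I \<subseteq> S" "indep M I" "card I = rank M S" by (rule rank_witness[OF M])
    obtain J where J: "J \<subseteq> closure M S" "indep M J" "card J = rank M (closure M S)"
      by (rule rank_witness[OF M])
    obtain e where e: "e \<in> J - I" "indep M (insert e I)"
      using indep_augment[OF M I(2) J(2)] less I J by auto
    have "card (insert e I) \<le> rank M (insert e S)"
      by (rule card_le_rank[OF M e(2)]) (use I in blast)
    moreover have "card (insert e I) = Suc (rank M S)"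
      using e I indep_finite[OF M I(2)] by simp
    ultimately show False using e J unfolding closure_def by auto
  qed
qed

lemma flat_closure:
  assumes M: "matroid M" and S: "S \<subseteq> ground M"
  shows "flat M (closure M S)"
proof -
  have "e \<in> closure M S" if e: "e \<in> closure M (closure M S)" for e
  proof -
    have "rank M (insert e S) \<le> rank M (insert e (closure M S))"
      by (rule rank_mono[OF M]) (use subset_closure[OF S] in blast)
    also have "\<dots> = rank M S" using e rank_closure[OF M S] unfolding closure_def by simp
    finally have "rank M (insert e S) = rank M S"
      using rank_mono[OF M, of S "insert e S"] by (simp add: antisym subset_insertI)
    then show ?thesis using e unfolding closure_def by simp
  qed
  then show ?thesis
    using subset_closure[OF closure_subset, of M S] closure_subset[of M S] unfolding flat_def by blast
qed

lemma in_closure_indep: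
  assumes M: "matroid M" and I: "indep M I" and e: "e \<in> closure M I" "e \<notin> I"
  shows "\<not> indep M (insert e I)"
proof
  assume "indep M (insert e I)"
  then have "card (insert e I) = card I"
    using e rank_indep[OF M] I unfolding closure_def by force
  then show False using e indep_finite[OF M I] by simp
qed

text \<open>Describes independence by closures alone; this is the bridge from flats to bases in
  \<open>matroid_eqI_flats\<close>.\<close>

lemma indep_iff_closure:
  assumes M: "matroid M"
  shows "indep M I \<longleftrightarrow> I \<subseteq> ground M \<and> (\<forall>e\<in>I. e \<notin> closure M (I - {e}))"
proof (intro iffI conjI ballI)
  assume I: "indep M I"
  show "I \<subseteq> ground M" by (rule indep_ground[OF M I])
  fix e assume e: "e \<in> I"
  show "e \<notin> closure M (I - {e})"
    using in_closure_indep[OF M indep_subset[OF I], of "I - {e}" e] I e by (auto simp: insert_absorb)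
next
  assume *: "I \<subseteq> ground M \<and> (\<forall>e\<in>I. e \<notin> closure M (I - {e}))"
  obtain J where J: "J \<subseteq> I" "indep M J" "card J = rank M I" by (rule rank_witness[OF M])
  show "indep M I"
  proof (cases "J = I")
    case False
    then obtain e where e: "e \<in> I" "e \<notin> J" using J by blast
    have "rank M I \<le> rank M (I - {e})"
      using J e rank_mono[OF M, of J "I - {e}"] rank_indep[OF M J(2)] by auto
    then have "rank M (insert e (I - {e})) = rank M (I - {e})"
      using e rank_mono[OF M, of "I - {e}" I] by (simp add: insert_absorb antisym)
    then show ?thesis using * e unfolding closure_def by blast
  qed (use J in simp)
qed

lemma bases_iff_maximal_indep:
  assumes M: "matroid M"
  shows "B \<in> bases M \<longleftrightarrow> indep M B \<and> (\<forall>I. indep M I \<and> B \<subseteq> I \<longrightarrow> I = B)"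
proof
  assume B: "B \<in> bases M"
  have "I = B" if "indep M I" "B \<subseteq> I" for I
  proof -
    obtain C where C: "C \<in> bases M" "I \<subseteq> C" using \<open>indep M I\<close> unfolding indep_def by blast
    then have "finite C" using bases_finite[OF M] by blast
    then have "B = C"
      using C \<open>B \<subseteq> I\<close> card_bases_eq[OF M B C(1)] by (metis card_subset_eq order_trans)
    then show ?thesis using C \<open>B \<subseteq> I\<close> by blast
  qed
  then show "indep M B \<and> (\<forall>I. indep M I \<and> B \<subseteq> I \<longrightarrow> I = B)"
    using B unfolding indep_def by blast
next
  assume "indep M B \<and> (\<forall>I. indep M I \<and> B \<subseteq> I \<longrightarrow> I = B)"
  then show "B \<in> bases M" unfolding indep_def by blast
qed

text \<open>The closure of a set is the smallest flat containing it. Flats therefore determine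
  closures, closures determine independence, and the bases are the maximal independent sets.\<close>

lemma matroid_eqI_flats:
  fixes M M' :: "'a set_system"
  assumes M: "matroid M" and M': "matroid M'" and g: "ground M = ground M'"
    and flats: "\<And>F. F \<subseteq> ground M \<Longrightarrow> flat M F \<longleftrightarrow> flat M' F"
  shows "M = M'"
proof -
  have le: "closure K S \<subseteq> closure L S"
    if "matroid K" "matroid L" "S \<subseteq> ground K" "ground K = ground L"
      "\<And>F. F \<subseteq> ground K \<Longrightarrow> flat K F \<longleftrightarrow> flat L F" for K L :: "'a set_system" and S
  proof -
    \<comment> \<open>A flat of \<open>K\<close> that contains \<open>S\<close> also contains the
      closure of \<open>S\<close> in \<open>K\<close>.\<close>
    have "flat K (closure L S)"
      using flat_closure[OF that(2), of S] that(3,4,5) closure_subset[of L S] by auto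
    then show ?thesis
      using closure_mono[OF that(1) subset_closure, of S L] that(3,4) unfolding flat_def by simp
  qed
  have "closure M S = closure M' S" if "S \<subseteq> ground M" for S
  proof (rule antisym)
    show "closure M S \<subseteq> closure M' S" by (rule le[OF M M' that g flats])
    show "closure M' S \<subseteq> closure M S" by (rule le[OF M' M]) (use that g flats in auto)
  qed
  then have cl: "closure M (I - {e}) = closure M' (I - {e})" if "I \<subseteq> ground M" for I e
    using that by blast
  have indep: "indep M I \<longleftrightarrow> indep M' I" for I
    unfolding indep_iff_closure[OF M] indep_iff_closure[OF M'] g[symmetric] by (auto simp: cl)
  have "bases M = bases M'"
    by (rule Set.set_eqI) (simp only: bases_iff_maximal_indep[OF M] bases_iff_maximal_indep[OF M'] indep)
  then show ?thesis using g by simp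
qed

section \<open>Restriction to a subset of the ground set\<close>

lemma indep_restriction:
  assumes M: "matroid M"
  shows "indep (restriction M T) I \<longleftrightarrow> I \<subseteq> T \<and> indep M I"
proof
  assume "indep (restriction M T) I"
  then show "I \<subseteq> T \<and> indep M I"
    unfolding indep_def[of "restriction M T"] by (auto simp: restriction_def intro: indep_subset)
next
  assume I: "I \<subseteq> T \<and> indep M I"
  then obtain J where J: "I \<subseteq> J" "J \<subseteq> T" "indep M J" "card J = rank M T"
    using indep_extend[OF M] by blast
  have "K = J" if "indep M K" "J \<subseteq> K" "K \<subseteq> T" for K
    using card_le_rank[OF M that(1,3)] J(4) that(2) indep_finite[OF M that(1)]
    by (metis card_seteq)
  then have "J \<in> bases (restriction M T)" unfolding restriction_def using J by simp
  then show "indep (restriction M T) I" using J unfolding indep_def by blast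
qed

lemma rank_restriction:
  assumes "matroid M" "S \<subseteq> T"
  shows "rank (restriction M T) S = rank M S"
proof -
  have "{card I |I. I \<subseteq> S \<and> indep (restriction M T) I} = {card I |I. I \<subseteq> S \<and> indep M I}"
    using assms(2) indep_restriction[OF assms(1)] by blast
  then show ?thesis unfolding rank_def by simp
qed

lemma closure_restriction:
  assumes "matroid M" "S \<subseteq> T" "T \<subseteq> ground M"
  shows "closure (restriction M T) S = closure M S \<inter> T"
proof -
  have "ground (restriction M T) = T" by (simp add: restriction_def)
  then show ?thesis
    using assms(2,3) rank_restriction[OF assms(1)] unfolding closure_def by auto
qed

section \<open>Flats of a matroid whose two parts meet in a modular flat\<close>

context
  fixes M :: "'a set_system" and E1 E2 :: "'a set"
  assumes M: "matroid M" and ground: "ground M = E1 \<union> E2"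
    and mod: "modular_flat (restriction M E1) (E1 \<inter> E2)"
    and rank_union: "rank M (E1 \<union> E2) + rank M (E1 \<inter> E2) = rank M E1 + rank M E2"
begin

text \<open>One inequality is submodularity for \<open>S1\<close> and \<open>S2\<close>. For the
  other, modularity of \<open>E1 \<inter> E2\<close> against \<open>S1\<close> is combined with two
  submodular inequalities, which carry the equation from \<open>E1\<close>, \<open>E2\<close> down
  to \<open>S1\<close>, \<open>S2\<close>.\<close>

lemma rank_glue:
  assumes S1: "flat (restriction M E1) S1" and S2: "S2 \<subseteq> E2" "S1 \<inter> E2 \<subseteq> S2"
  shows "rank M (S1 \<union> S2) + rank M (S1 \<inter> E2) = rank M S1 + rank M S2"
proof -
  have sub: "S1 \<subseteq> E1" using S1 unfolding flat_def restriction_def by simp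
  have "rank M (E1 \<inter> E2) + rank M S1 = rank M (E1 \<inter> E2 \<union> S1) + rank M (E1 \<inter> E2 \<inter> S1)"
  proof -
    have "rank (restriction M E1) S = rank M S" if "S \<subseteq> E1" for S
      by (rule rank_restriction[OF M that])
    moreover have "E1 \<inter> E2 \<union> S1 \<subseteq> E1" "E1 \<inter> E2 \<inter> S1 \<subseteq> E1" "E1 \<inter> E2 \<subseteq> E1" using sub by auto
    ultimately show ?thesis using mod S1 sub unfolding modular_flat_def by metis
  qed
  moreover have "rank M (E1 \<inter> E2 \<inter> S1) = rank M (S1 \<inter> E2)"
    using sub by (intro arg_cong[of _ _ "rank M"]) blast
  moreover have "rank M (E1 \<union> E2) + rank M (E1 \<inter> E2 \<union> S1) \<le> rank M (S1 \<union> E2) + rank M E1"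
    by (rule rank_submodular_le[OF M]) (use sub in auto)
  moreover have "rank M (S1 \<union> E2) + rank M S2 \<le> rank M (S1 \<union> S2) + rank M E2"
    by (rule rank_submodular_le[OF M]) (use S2 in auto)
  moreover have "rank M (S1 \<union> S2) + rank M (S1 \<inter> E2) \<le> rank M S1 + rank M S2"
    by (rule rank_submodular_le[OF M]) (use S2 in auto)
  ultimately show ?thesis using rank_union by linarith
qed

text \<open>Traces of flats are flats because closure is monotone. For the converse, an element of
  the closure of \<open>F\<close> is added to the trace on its side, and \<open>rank_glue\<close>
  shows that the rank of this trace does not grow.\<close>

lemma flat_glue:
  assumes F: "F \<subseteq> E1 \<union> E2"
  shows "flat M F \<longleftrightarrow> flat (restriction M E1) (F \<inter> E1) \<and> flat (restriction M E2) (F \<inter> E2)"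
proof -
  have fl: "flat (restriction M E) (F \<inter> E) \<longleftrightarrow> closure M (F \<inter> E) \<inter> E = F \<inter> E" if "E = E1 \<or> E = E2" for E
  proof -
    have "closure (restriction M E) (F \<inter> E) = closure M (F \<inter> E) \<inter> E"
      by (rule closure_restriction[OF M]) (use that ground in auto)
    then show ?thesis unfolding flat_def by (simp add: restriction_def)
  qed
  show ?thesis
  proof
    assume "flat M F"
    then have "closure M (F \<inter> E) \<inter> E \<subseteq> F \<inter> E" for E
      using closure_mono[OF M, of "F \<inter> E" F] unfolding flat_def by blast
    moreover have "F \<inter> E \<subseteq> closure M (F \<inter> E)" for E
      by (rule subset_closure) (use F ground in auto)
    ultimately have "closure M (F \<inter> E) \<inter> E = F \<inter> E" for E by blast
    then show "flat (restriction M E1) (F \<inter> E1) \<and> flat (restriction M E2) (F \<inter> E2)"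
      using fl by simp
  next
    assume *: "flat (restriction M E1) (F \<inter> E1) \<and> flat (restriction M E2) (F \<inter> E2)"
    let ?F1 = "F \<inter> E1" and ?F2 = "F \<inter> E2"
    have c1: "closure M ?F1 \<inter> E1 = ?F1" and c2: "closure M ?F2 \<inter> E2 = ?F2" using * fl by auto
    have Feq: "?F1 \<union> ?F2 = F" using F by blast
    have rF: "rank M F + rank M (?F1 \<inter> E2) = rank M ?F1 + rank M ?F2"
      using rank_glue[of ?F1 ?F2] * Feq by auto
    \<comment> \<open>The side \<open>E2\<close> comes first because \<open>rank_glue\<close>
      accepts any second set large enough, so \<open>e\<close> can be added to \<open>?F2\<close>
      directly.\<close>
    have in2: "e \<in> F" if e: "e \<in> closure M F" "e \<in> E2" for e
    proof (cases "e \<in> E1 \<and> e \<in> F")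
      case False
      have "rank M (?F1 \<union> insert e ?F2) + rank M (?F1 \<inter> E2) = rank M ?F1 + rank M (insert e ?F2)"
        by (rule rank_glue) (use * e in auto)
      moreover have "?F1 \<union> insert e ?F2 = insert e F" using Feq by blast
      moreover have "rank M (insert e F) = rank M F" using e unfolding closure_def by simp
      ultimately have "rank M (insert e ?F2) = rank M ?F2" using rF by simp
      then have "e \<in> closure M ?F2" using e ground unfolding closure_def by simp
      then show ?thesis using c2 e by blast
    qed simp
    have in1: "e \<in> F" if e: "e \<in> closure M F" "e \<in> E1" for e
    proof -
      \<comment> \<open>The first argument of \<open>rank_glue\<close> must be a flat, which
        \<open>insert e ?F1\<close> need not be, so its closure in \<open>E1\<close> replaces it. By
        \<open>in2\<close> this closure meets \<open>E2\<close> in nothing beyond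
        \<open>?F1 \<inter> E2\<close>.\<close>
      let ?C = "closure M (insert e ?F1) \<inter> E1"
      have insE: "insert e ?F1 \<subseteq> E1" using e by blast
      have C: "?C = closure (restriction M E1) (insert e ?F1)"
        by (rule closure_restriction[OF M insE, symmetric]) (simp add: ground)
      have cl: "closure M (insert e F) \<subseteq> closure M F"
      proof
        fix f assume f: "f \<in> closure M (insert e F)"
        have "insert e F \<subseteq> closure M F" using subset_closure[of F M] F ground e by blast
        then have "f \<in> closure M (closure M F)" using closure_mono[OF M] f by blast
        then show "f \<in> closure M F" using flat_closure[OF M, of F] F ground unfolding flat_def by simp
      qed
      have CF: "?C \<subseteq> closure M F"
        using closure_mono[OF M, of "insert e ?F1" "insert e F"] cl by blast
      have C2: "?C \<inter> E2 \<subseteq> ?F2" using CF in2 by blast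
      moreover have FC: "insert e ?F1 \<subseteq> ?C"
        using subset_closure[of "insert e ?F1" M] insE ground by blast
      ultimately have eq: "?C \<inter> E2 = ?F1 \<inter> E2" by blast
      have ground1: "ground (restriction M E1) = E1" by (simp add: restriction_def)
      have "rank M (?C \<union> ?F2) + rank M (?C \<inter> E2) = rank M ?C + rank M ?F2"
      proof (rule rank_glue)
        show "flat (restriction M E1) ?C"
          unfolding flat_def
        proof
          show "?C \<subseteq> ground (restriction M E1)" using ground1 by simp
          have "closure M ?C \<subseteq> closure M (insert e ?F1)"
            using closure_mono[OF M, of ?C "closure M (insert e ?F1)"]
              flat_closure[OF M, of "insert e ?F1"] insE ground unfolding flat_def by auto
          moreover have "?C \<subseteq> closure M ?C" by (rule subset_closure) (use ground in auto)
          ultimately have "closure M ?C \<inter> E1 = ?C" by blast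
          then show "closure (restriction M E1) ?C = ?C"
            using closure_restriction[OF M, of ?C E1] ground by simp
        qed
      qed (use C2 in auto)
      moreover have "rank M (?C \<union> ?F2) \<le> rank M F"
      proof -
        have "?F2 \<subseteq> closure M F" using subset_closure[of F M] F ground by blast
        then have "rank M (?C \<union> ?F2) \<le> rank M (closure M F)"
          using CF by (intro rank_mono[OF M]) blast
        then show ?thesis using rank_closure[OF M, of F] F ground by simp
      qed
      ultimately have "rank M ?C \<le> rank M ?F1" using rF eq by simp
      then have "rank M (insert e ?F1) \<le> rank M ?F1" using rank_mono[OF M FC] by simp
      moreover have "rank M ?F1 \<le> rank M (insert e ?F1)" by (rule rank_mono[OF M]) blast
      ultimately have "e \<in> closure M ?F1" using e ground unfolding closure_def by simp
      then show ?thesis using c1 e by blast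
    qed
    have "closure M F \<subseteq> F" using in1 in2 closure_subset[of M F] ground by blast
    then show "flat M F" using subset_closure[of F M] F ground unfolding flat_def by blast
  qed
qed

end

section \<open>Determinants of labelled matrices over commutative rings\<close>

text \<open>Strips one identity column at a time in \<open>det_mat_upper_right_zero\<close> and
  gives determinant 0 for a zero last column in \<open>sub_det_low_rank\<close>.\<close>

lemma det_mat_last_col:
  fixes f :: "nat \<times> nat \<Rightarrow> 'r::comm_ring_1"
  assumes "\<And>i. i < n \<Longrightarrow> f (i, n) = 0"
  shows "det (mat (Suc n) (Suc n) f) = det (mat n n f) * f (n, n)"
proof -
  let ?D = "mat 1 1 (\<lambda>_. f (n, n))"
  have "mat (Suc n) (Suc n) f
      = four_block_mat (mat n n f) (0\<^sub>m n 1) (mat 1 n (\<lambda>(i, j). f (n, j))) ?D"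
    by (rule eq_matI) (auto simp: assms less_Suc_eq)
  also have "det \<dots> = det (mat n n f) * det ?D"
    by (rule det_four_block_mat_upper_right_zero_col) auto
  also have "det ?D = f (n, n)" by (simp add: det_single)
  finally show ?thesis .
qed

lemma det_mat_first_col:
  fixes f :: "nat \<times> nat \<Rightarrow> 'r::comm_ring_1"
  assumes "\<And>i. i < n \<Longrightarrow> f (Suc i, 0) = 0"
  shows "det (mat (Suc n) (Suc n) f) = f (0, 0) * det (mat n n (\<lambda>(i, j). f (Suc i, Suc j)))"
proof -
  let ?A = "mat 1 1 (\<lambda>_. f (0, 0))"
  have "mat (Suc n) (Suc n) f
      = four_block_mat ?A (mat 1 n (\<lambda>(i, j). f (0, Suc j))) (0\<^sub>m n 1)
          (mat n n (\<lambda>(i, j). f (Suc i, Suc j)))"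
    by (rule eq_matI) (auto simp: assms less_Suc_eq_0_disj)
  also have "det \<dots> = det ?A * det (mat n n (\<lambda>(i, j). f (Suc i, Suc j)))"
    by (rule det_four_block_mat_lower_left_zero_col) auto
  also have "det ?A = f (0, 0)" by (simp add: det_single)
  finally show ?thesis .
qed

text \<open>
  The library states this for integral domains only. Over a commutative ring it follows from the
  factorization \<open>(A 0; C D) = (A 0; C I) (I 0; 0 D)\<close>.
\<close>

lemma det_mat_upper_right_zero:
  fixes f :: "nat \<times> nat \<Rightarrow> 'r::comm_ring_1"
  assumes zero: "\<And>i j. i < n \<Longrightarrow> n \<le> j \<Longrightarrow> j < n + m \<Longrightarrow> f (i, j) = 0"
  shows "det (mat (n + m) (n + m) f) = det (mat n n f) * det (mat m m (\<lambda>(i, j). f (n + i, n + j)))"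
proof -
  define g where "g = (\<lambda>(i, j). if j < n then f (i, j) else if i = j then 1 else 0)"
  define h where "h = (\<lambda>(i, j). if j < n then (if i = j then 1 else 0)
                               else if i < n then 0 else f (i, j))"
  have "mat (n + m) (n + m) f = mat (n + m) (n + m) g * mat (n + m) (n + m) h"
  proof (rule eq_matI)
    fix i j assume "i < dim_row (mat (n + m) (n + m) g * mat (n + m) (n + m) h)"
      "j < dim_col (mat (n + m) (n + m) g * mat (n + m) (n + m) h)"
    then have ij: "i < n + m" "j < n + m" by auto
    \<comment> \<open>At most one \<open>k\<close> contributes: \<open>k = j\<close> if
      \<open>j < n\<close>, since column \<open>j\<close> of \<open>h\<close> is then a unit vector,
      and \<open>k = i\<close> otherwise. For \<open>i < n \<le> j\<close> the term is 0, in
      accordance with \<open>zero\<close>.\<close>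
    have "(\<Sum>k = 0..<n + m. g (i, k) * h (k, j))
        = (\<Sum>k = 0..<n + m. if k = (if j < n then j else i) then f (i, j) else 0)"
      by (rule sum.cong) (use ij zero in \<open>auto simp: g_def h_def\<close>)
    also have "\<dots> = f (i, j)" using ij by simp
    finally show "mat (n + m) (n + m) f $$ (i, j)
        = (mat (n + m) (n + m) g * mat (n + m) (n + m) h) $$ (i, j)"
      using ij by (simp add: scalar_prod_def)
  qed auto
  then have "det (mat (n + m) (n + m) f) = det (mat (n + m) (n + m) g) * det (mat (n + m) (n + m) h)"
    by (simp add: det_mult[of _ "n + m"])
  \<comment> \<open>The size of the identity block of \<open>g\<close> varies, so that its columns
    can be peeled off from the end.\<close>
  moreover have "det (mat (n + k) (n + k) g) = det (mat n n f)" for k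
  proof (induction k)
    case 0
    have "mat n n g = mat n n f" by (rule eq_matI) (auto simp: g_def)
    then show ?case by simp
  next
    case (Suc k)
    then show ?case by (simp add: det_mat_last_col g_def)
  qed
  \<comment> \<open>Here the identity block of \<open>h\<close> is peeled off from the front.
    \<open>l\<close> counts the identity rows that remain, whence the shift by \<open>n - l\<close>;
    at \<open>l = 0\<close> only the lower right block is left.\<close>
  moreover have "det (mat (l + m) (l + m) (\<lambda>(i, j). h (n - l + i, n - l + j)))
      = det (mat m m (\<lambda>(i, j). f (n + i, n + j)))" if "l \<le> n" for l
    using that
  proof (induction l)
    case 0
    have "mat m m (\<lambda>(i, j). h (n + i, n + j)) = mat m m (\<lambda>(i, j). f (n + i, n + j))"
      by (rule eq_matI) (auto simp: h_def)
    then show ?case by simp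
  next
    case (Suc l)
    let ?h = "\<lambda>(i, j). h (n - Suc l + i, n - Suc l + j)"
    have "n - Suc l + Suc i = n - l + i" for i using Suc.prems by simp
    moreover have "?h (0, 0) = 1" using Suc.prems by (simp add: h_def)
    moreover have "?h (Suc i, 0) = 0" for i using Suc.prems by (simp add: h_def)
    ultimately show ?case
      using det_mat_first_col[of "l + m" ?h] Suc by simp
  qed
  from this[of n] have "det (mat (n + m) (n + m) h) = det (mat m m (\<lambda>(i, j). f (n + i, n + j)))"
    by (simp add: case_prod_eta)
  ultimately show ?thesis by simp
qed

lemma det_list_submatrix_block:
  fixes a :: "('a, 'r::comm_ring_1) lmatrix"
  assumes len: "length xs = length ys" "length xs' = length ys'"
    and zero: "\<And>x y. x \<in> set xs \<Longrightarrow> y \<in> set ys' \<Longrightarrow> a x y = 0"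
  shows "det (list_submatrix a (xs @ xs') (ys @ ys'))
       = det (list_submatrix a xs ys) * det (list_submatrix a xs' ys')"
proof -
  let ?f = "\<lambda>(i, j). a ((xs @ xs') ! i) ((ys @ ys') ! j)" and ?n = "length ys" and ?m = "length ys'"
  have "det (mat (?n + ?m) (?n + ?m) ?f)
      = det (mat ?n ?n ?f) * det (mat ?m ?m (\<lambda>(i, j). ?f (?n + i, ?n + j)))"
  proof (rule det_mat_upper_right_zero)
    fix i j assume "i < ?n" "?n \<le> j" "j < ?n + ?m"
    then show "?f (i, j) = 0" using len by (simp add: nth_append zero)
  qed
  moreover have "mat ?n ?n ?f = list_submatrix a xs ys"
    by (rule eq_matI) (auto simp: list_submatrix_def nth_append len)
  moreover have "mat ?m ?m (\<lambda>(i, j). ?f (?n + i, ?n + j)) = list_submatrix a xs' ys'"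
    by (rule eq_matI) (auto simp: list_submatrix_def nth_append len)
  ultimately show ?thesis by (simp add: list_submatrix_def len)
qed

text \<open>\<open>sub_det\<close> depends on chosen enumerations, and this relation is what
  survives a change of them. It respects being 0 and, in a partial field, membership in
  \<open>insert 0 G\<close>.\<close>

definition eq_upto_sign :: "'r::comm_ring_1 \<Rightarrow> 'r \<Rightarrow> bool" (infix "=\<^sub>\<plusminus>" 50) where
  "a =\<^sub>\<plusminus> b \<longleftrightarrow> a = b \<or> a = - b"

lemma eq_upto_sign_refl: "a =\<^sub>\<plusminus> a"
  by (simp add: eq_upto_sign_def)

lemma eq_upto_sign_sym: "a =\<^sub>\<plusminus> b \<Longrightarrow> b =\<^sub>\<plusminus> a"
  by (auto simp: eq_upto_sign_def)

lemma eq_upto_sign_trans [trans]: "a =\<^sub>\<plusminus> b \<Longrightarrow> b =\<^sub>\<plusminus> c \<Longrightarrow> a =\<^sub>\<plusminus> c"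
  by (auto simp: eq_upto_sign_def)

lemma eq_upto_sign_mult: "a =\<^sub>\<plusminus> b \<Longrightarrow> c =\<^sub>\<plusminus> d \<Longrightarrow> a * c =\<^sub>\<plusminus> b * d"
  by (auto simp: eq_upto_sign_def)

lemma eq_upto_sign_zero: "a =\<^sub>\<plusminus> b \<Longrightarrow> a = 0 \<longleftrightarrow> b = 0"
  by (auto simp: eq_upto_sign_def)

lemma sub_det_set:
  assumes "distinct xs" "distinct ys" "length xs = length ys"
  shows "sub_det a (set xs) (set ys) =\<^sub>\<plusminus> det (list_submatrix a xs ys)"
  unfolding eq_upto_sign_def by (rule sub_det_sign[OF assms])

text \<open>A true equality, not just one up to sign, because both sides use the same
  enumerations.\<close>

lemma sub_det_cong:
  assumes "finite S" "finite T" "card S = card T" "\<And>x y. x \<in> S \<Longrightarrow> y \<in> T \<Longrightarrow> a x y = b x y"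
  shows "sub_det a S T = sub_det b S T"
proof -
  have "list_submatrix a (enum_of S) (enum_of T) = list_submatrix b (enum_of S) (enum_of T)"
    using enum_of[OF assms(1)] enum_of[OF assms(2)]
    by (intro eq_matI) (auto simp: list_submatrix_def intro!: assms(4))
  then show ?thesis by (simp add: sub_det_def)
qed

lemma finite_set_lists:
  assumes "finite S" "finite T" "card S = card T"
  obtains xs ys where "distinct xs" "set xs = S" "distinct ys" "set ys = T"
    "length xs = card S" "length ys = card S"
  using assms finite_distinct_list by (metis distinct_card)

lemma sub_det_block:
  fixes a :: "('a, 'r::comm_ring_1) lmatrix"
  assumes fin: "finite S" "finite S'" "finite T" "finite T'"
    and disj: "S \<inter> S' = {}" "T \<inter> T' = {}" and card: "card S = card T" "card S' = card T'"
    and zero: "\<And>x y. x \<in> S \<Longrightarrow> y \<in> T' \<Longrightarrow> a x y = 0"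
  shows "sub_det a (S \<union> S') (T \<union> T') =\<^sub>\<plusminus> sub_det a S T * sub_det a S' T'"
proof -
  obtain xs ys where 1: "distinct xs" "set xs = S" "distinct ys" "set ys = T"
    "length xs = card S" "length ys = card S" using finite_set_lists[OF fin(1,3) card(1)] .
  obtain xs' ys' where 2: "distinct xs'" "set xs' = S'" "distinct ys'" "set ys' = T'"
    "length xs' = card S'" "length ys' = card S'" using finite_set_lists[OF fin(2,4) card(2)] .
  have "sub_det a (set (xs @ xs')) (set (ys @ ys')) =\<^sub>\<plusminus> det (list_submatrix a (xs @ xs') (ys @ ys'))"
    by (rule sub_det_set) (use 1 2 disj in auto)
  also have "det (list_submatrix a (xs @ xs') (ys @ ys'))
      = det (list_submatrix a xs ys) * det (list_submatrix a xs' ys')"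
    by (rule det_list_submatrix_block) (use 1 2 zero in auto)
  also have "\<dots> =\<^sub>\<plusminus> sub_det a (set xs) (set ys) * sub_det a (set xs') (set ys')"
    by (intro eq_upto_sign_mult eq_upto_sign_sym[OF sub_det_set]) (use 1 2 in auto)
  finally show ?thesis using 1 2 by simp
qed

text \<open>Cramer's rule in division-free form, hence valid over any commutative ring.\<close>

lemma det_replace_column:
  fixes a :: "('a, 'r::comm_ring_1) lmatrix"
  assumes len: "length xs = n" "length ys = n" and k: "k < n"
    and comb: "\<And>x. x \<in> set xs \<Longrightarrow> a x y = (\<Sum>j<n. c j * a x (ys ! j))"
  shows "det (list_submatrix a xs (ys[k := y])) = c k * det (list_submatrix a xs ys)"
proof -
  let ?A = "list_submatrix a xs ys"
  have A: "?A \<in> carrier_mat n n" by (simp add: list_submatrix_def len)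
  have "list_submatrix a xs (ys[k := y]) = replace_col ?A (?A *\<^sub>v vec n c) k"
    by (rule eq_matI)
      (auto simp: list_submatrix_def replace_col_def len comb scalar_prod_def nth_list_update
        atLeast0LessThan mult.commute)
  then show ?thesis using cramer_lemma_mat[OF A, of "vec n c" k] k by simp
qed

lemma sum_nth_distinct: "distinct ys \<Longrightarrow> (\<Sum>j<length ys. f (ys ! j)) = (\<Sum>y\<in>set ys. f y)"
  by (rule sum.reindex_bij_betw[OF bij_betw_nth]) auto

text \<open>The workhorse for exchanging columns. The condition on \<open>y\<close> keeps the new
  column list distinct and still admits \<open>y = b\<close>, which
  \<open>sub_det_dependent_column\<close> exploits.\<close>

lemma sub_det_exchange:
  fixes a :: "('a, 'r::comm_ring_1) lmatrix"
  assumes fin: "finite X" "finite B" "card X = card B" and b: "b \<in> B" and y: "y \<notin> B - {b}"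
    and comb: "\<And>x. x \<in> X \<Longrightarrow> a x y = (\<Sum>j\<in>B. c j * a x j)"
  shows "sub_det a X (insert y (B - {b})) =\<^sub>\<plusminus> c b * sub_det a X B"
proof -
  obtain xs ys where l: "distinct xs" "set xs = X" "distinct ys" "set ys = B"
    "length xs = card X" "length ys = card X" using finite_set_lists[OF fin] .
  then obtain k where k: "k < card X" "ys ! k = b" using b by (metis in_set_conv_nth)
  have set: "set (ys[k := y]) = insert y (B - {b})"
    using l k by (simp add: set_update_distinct)
  have "distinct (ys[k := y])" using l k y by (simp add: distinct_list_update)
  then have "sub_det a X (insert y (B - {b})) =\<^sub>\<plusminus> det (list_submatrix a xs (ys[k := y]))"
    using sub_det_set[of xs "ys[k := y]" a] l set by simp
  also have "\<dots> = c b * det (list_submatrix a xs ys)"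
    using det_replace_column[of xs "card X" ys k a y "\<lambda>j. c (ys ! j)"] l k
      sum_nth_distinct[of ys "\<lambda>j. c j * a _ j"] comb by simp
  also have "\<dots> =\<^sub>\<plusminus> c b * sub_det a X B"
    using eq_upto_sign_mult[OF eq_upto_sign_refl eq_upto_sign_sym[OF sub_det_set]] l by metis
  finally show ?thesis .
qed

text \<open>Exchanging \<open>y\<close> for itself leaves the minor unchanged, yet multiplies it, up
  to sign, by the coefficient of \<open>y\<close>, which is 0.\<close>

lemma sub_det_dependent_column:
  fixes a :: "('a, 'r::comm_ring_1) lmatrix"
  assumes fin: "finite X" "finite B" "card X = card B" and y: "y \<in> B" and P: "P \<subseteq> B - {y}"
    and comb: "\<And>x. x \<in> X \<Longrightarrow> a x y = (\<Sum>j\<in>P. c j * a x j)"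
  shows "sub_det a X B = 0"
proof -
  let ?c = "\<lambda>j. if j \<in> P then c j else 0"
  have "(\<Sum>j\<in>P. c j * a x j) = (\<Sum>j\<in>B. ?c j * a x j)" for x
    by (rule sum.mono_neutral_cong_left) (use P fin in auto)
  then have "sub_det a X (insert y (B - {y})) =\<^sub>\<plusminus> ?c y * sub_det a X B"
    using comb by (intro sub_det_exchange[OF fin y]) auto
  moreover have "y \<notin> P" using P by auto
  ultimately show ?thesis using y by (simp add: insert_absorb eq_upto_sign_def)
qed

lemma sub_det_zero_column:
  fixes a :: "('a, 'r::comm_ring_1) lmatrix"
  assumes "finite X" "finite B" "card X = card B" "y \<in> B" "\<And>x. x \<in> X \<Longrightarrow> a x y = 0"
  shows "sub_det a X B = 0"
  by (rule sub_det_dependent_column[OF assms(1-4), of "{}"]) (use assms(5) in auto)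

text \<open>The rows \<open>S\<close> are supported on too few columns. Padding \<open>T\<close> by
  columns \<open>U\<close> of \<open>T'\<close> gives a block triangular matrix with a square block
  on \<open>S\<close> that has a zero column.\<close>

lemma sub_det_deficient_block:
  fixes a :: "('a, 'r::comm_ring_1) lmatrix"
  assumes fin: "finite S" "finite S'" "finite T" "finite T'"
    and disj: "S \<inter> S' = {}" "T \<inter> T' = {}" and less: "card T < card S"
    and card: "card (S \<union> S') = card (T \<union> T')"
    and zero: "\<And>x y. x \<in> S \<Longrightarrow> y \<in> T' \<Longrightarrow> a x y = 0"
  shows "sub_det a (S \<union> S') (T \<union> T') = 0"
proof -
  have c: "card S + card S' = card T + card T'" using card fin disj by (simp add: card_Un_disjoint)
  then have "card S - card T \<le> card T'" by linarith
  then obtain U where U: "U \<subseteq> T'" "card U = card S - card T"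
    by (rule obtain_subset_with_card_n)
  have finU: "finite U" using U fin finite_subset by blast
  have cU: "card (T \<union> U) = card S" using U fin finU disj less
    by (subst card_Un_disjoint) auto
  have "T \<union> T' = (T \<union> U) \<union> (T' - U)" using U by blast
  moreover have "sub_det a (S \<union> S') ((T \<union> U) \<union> (T' - U)) =\<^sub>\<plusminus> sub_det a S (T \<union> U) * sub_det a S' (T' - U)"
  proof (rule sub_det_block)
    show "card S' = card (T' - U)" using U finU c less by (simp add: card_Diff_subset)
  qed (use fin disj finU cU U zero in auto)
  moreover have "U \<noteq> {}" using U less by auto
  then obtain u where "u \<in> U" by blast
  then have "sub_det a S (T \<union> U) = 0"
    by (intro sub_det_zero_column[where y = u]) (use fin finU cU U zero in auto)
  ultimately show ?thesis by (simp add: eq_upto_sign_def)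
qed

text \<open>If \<open>u\<close> inverts the determinant, then \<open>u\<close> times the adjugate is
  the inverse matrix; applied to the column \<open>y\<close> it yields the coefficients.\<close>

lemma unit_sub_det_spans:
  fixes a :: "('a, 'r::comm_ring_1) lmatrix"
  assumes fin: "finite X" "finite B" "card X = card B" and unit: "sub_det a X B dvd 1"
  obtains c where "\<And>x. x \<in> X \<Longrightarrow> a x y = (\<Sum>j\<in>B. c j * a x j)"
proof -
  obtain xs ys where l: "distinct xs" "set xs = X" "distinct ys" "set ys = B"
    "length xs = card X" "length ys = card X" using finite_set_lists[OF fin] .
  let ?n = "card X" and ?A = "list_submatrix a xs ys"
  let ?w = "vec ?n (\<lambda>i. a (xs ! i) y)"
  have A: "?A \<in> carrier_mat ?n ?n" by (simp add: list_submatrix_def l)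
  have "sub_det a X B =\<^sub>\<plusminus> det ?A" using sub_det_set[of xs ys a] l by simp
  then have "det ?A dvd 1" using unit by (auto simp: eq_upto_sign_def)
  then obtain u where u: "1 = det ?A * u" by (rule dvdE)
  define z where "z = adj_mat ?A *\<^sub>v (u \<cdot>\<^sub>v ?w)"
  have z: "z \<in> carrier_vec ?n" using adj_mat(1)[OF A] by (simp add: z_def)
  have "?A *\<^sub>v z = (?A * adj_mat ?A) *\<^sub>v (u \<cdot>\<^sub>v ?w)"
    unfolding z_def using A adj_mat(1)[OF A] by (intro assoc_mult_mat_vec[symmetric]) auto
  also have "\<dots> = det ?A \<cdot>\<^sub>v (u \<cdot>\<^sub>v ?w)"
    unfolding adj_mat(2)[OF A] by (intro eq_vecI) auto
  also have "\<dots> = ?w" using u by (intro eq_vecI) (auto simp flip: mult.assoc)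
  finally have Az: "?A *\<^sub>v z = ?w" .
  \<comment> \<open>Turns the coefficients indexed by positions in \<open>ys\<close> into
    coefficients indexed by labels; \<open>ys\<close> is distinct, so the position is unique on
    \<open>B\<close>.\<close>
  define c where "c = (\<lambda>j. z $ (THE k. k < ?n \<and> ys ! k = j))"
  have c: "c (ys ! k) = z $ k" if "k < ?n" for k
  proof -
    have "(THE k'. k' < ?n \<and> ys ! k' = ys ! k) = k"
      by (rule the_equality) (use that l in \<open>auto simp: nth_eq_iff_index_eq\<close>)
    then show ?thesis by (simp add: c_def)
  qed
  have "a x y = (\<Sum>j\<in>B. c j * a x j)" if "x \<in> X" for x
  proof -
    have "x \<in> set xs" using that l(2) by simp
    then obtain i where i: "i < ?n" "x = xs ! i" using l(5) by (auto simp: in_set_conv_nth)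
    have "a x y = (?A *\<^sub>v z) $ i" using Az i by simp
    also have "\<dots> = (\<Sum>k<?n. a x (ys ! k) * z $ k)"
      using i z l by (simp add: scalar_prod_def list_submatrix_def atLeast0LessThan)
    also have "\<dots> = (\<Sum>k<?n. c (ys ! k) * a x (ys ! k))"
      by (rule sum.cong) (simp_all add: c mult.commute)
    also have "\<dots> = (\<Sum>j\<in>B. c j * a x j)"
      using sum_nth_distinct[OF l(3), of "\<lambda>j. c j * a x j"] l by simp
    finally show ?thesis .
  qed
  then show ?thesis using that by blast
qed

text \<open>The submatrix factors through fewer than \<open>card X\<close> columns.\<close>

lemma sub_det_low_rank:
  fixes a :: "('a, 'r::comm_ring_1) lmatrix"
  assumes fin: "finite X" "finite C" "card X = card C" and S: "finite S" "card S < card X"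
    and comb: "\<And>y x. y \<in> C \<Longrightarrow> x \<in> X \<Longrightarrow> a x y = (\<Sum>j\<in>S. c y j * a x j)"
  shows "sub_det a X C = 0"
proof -
  obtain xs ys where l: "distinct xs" "set xs = X" "distinct ys" "set ys = C"
    "length xs = card X" "length ys = card X" using finite_set_lists[OF fin] .
  let ?n = "card X"
  obtain zs where zs: "distinct zs" "set zs = S" using finite_distinct_list[OF S(1)] by blast
  have len: "length zs < ?n" using zs S by (metis distinct_card)
  \<comment> \<open>Both factors are padded with zeros to square matrices, so that determinants
    multiply; the last column of \<open>?P\<close> is zero as \<open>length zs < ?n\<close>.\<close>
  let ?P = "mat ?n ?n (\<lambda>(i, k). if k < length zs then a (xs ! i) (zs ! k) else 0)"
  let ?Q = "mat ?n ?n (\<lambda>(k, j). if k < length zs then c (ys ! j) (zs ! k) else 0)"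
  have "list_submatrix a xs ys = ?P * ?Q"
  proof (rule eq_matI)
    fix i j assume "i < dim_row (?P * ?Q)" "j < dim_col (?P * ?Q)"
    then have ij: "i < ?n" "j < ?n" by auto
    have "a (xs ! i) (ys ! j) = (\<Sum>s\<in>S. c (ys ! j) s * a (xs ! i) s)"
      using comb ij l nth_mem by metis
    also have "\<dots> = (\<Sum>k<length zs. c (ys ! j) (zs ! k) * a (xs ! i) (zs ! k))"
      using sum_nth_distinct[OF zs(1), of "\<lambda>s. c (ys ! j) s * a (xs ! i) s"] zs by simp
    also have "\<dots> = (\<Sum>k<?n. ?P $$ (i, k) * ?Q $$ (k, j))"
      by (rule sum.mono_neutral_cong_left) (use len ij in \<open>auto simp: mult.commute\<close>)
    also have "\<dots> = (?P * ?Q) $$ (i, j)"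
      using ij by (simp add: scalar_prod_def atLeast0LessThan)
    finally show "list_submatrix a xs ys $$ (i, j) = (?P * ?Q) $$ (i, j)"
      using ij l by (simp add: list_submatrix_def)
  qed (auto simp: list_submatrix_def l)
  moreover have "det ?P = 0"
  proof -
    let ?k = "?n - 1"
    have "?n = Suc ?k" using len by simp
    moreover have "det (mat (Suc ?k) (Suc ?k) (\<lambda>(i, k). if k < length zs then a (xs ! i) (zs ! k) else 0)) = 0"
      by (subst det_mat_last_col) (use len in auto)
    ultimately show ?thesis by simp
  qed
  ultimately have "det (list_submatrix a xs ys) = 0" by (simp add: det_mult[of _ ?n])
  then show ?thesis using sub_det_set[of xs ys a] l by (simp add: eq_upto_sign_def)
qed

section \<open>Column matroids of matrices over a partial field\<close>

definition maximal_minors_in :: "'r::comm_ring_1 set \<Rightarrow> 'a set \<Rightarrow> 'a set \<Rightarrow> ('a, 'r) lmatrix \<Rightarrow> bool" where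
  "maximal_minors_in G R E a \<longleftrightarrow> (\<forall>B\<subseteq>E. card B = card R \<longrightarrow> sub_det a R B \<in> insert 0 G)"

text \<open>In contrast to \<open>matroid_of\<close>, the identity columns are ordinary columns of
  \<open>a\<close>. Restrictions to column sets can thus be written in the same form, as in
  \<open>restriction_zero_block\<close>.\<close>

definition column_matroid :: "'a set \<Rightarrow> 'a set \<Rightarrow> ('a, 'r::comm_ring_1) lmatrix \<Rightarrow> 'a set_system" where
  "column_matroid R E a =
     \<lparr>ground = E, bases = {B. B \<subseteq> E \<and> card B = card R \<and> sub_det a R B \<noteq> 0}\<rparr>"

lemma partial_field_unit: "partial_field G \<Longrightarrow> g \<in> G \<Longrightarrow> g dvd 1"
  unfolding partial_field_def by (metis dvdI)

lemma partial_field_uminus: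
  assumes "partial_field G" "g \<in> G" shows "- g \<in> G"
proof -
  have "(- 1) * g \<in> G" using assms unfolding partial_field_def by blast
  then show ?thesis by simp
qed

lemma partial_field_eq_upto_sign:
  "partial_field G \<Longrightarrow> a =\<^sub>\<plusminus> b \<Longrightarrow> b \<in> insert 0 G \<Longrightarrow> a \<in> insert 0 G"
  using partial_field_uminus by (auto simp: eq_upto_sign_def)

lemma partial_field_mult:
  "partial_field G \<Longrightarrow> a \<in> insert 0 G \<Longrightarrow> b \<in> insert 0 G \<Longrightarrow> a * b \<in> insert 0 G"
  unfolding partial_field_def by auto

lemma partial_field_cancel:
  assumes G: "partial_field G" and g: "g \<in> G" and ag: "a * g \<in> insert 0 G"
  shows "a \<in> insert 0 G"
proof -
  obtain h where h: "h \<in> G" "g * h = 1" using G g unfolding partial_field_def by blast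
  have "a * g * h \<in> insert 0 G" by (rule partial_field_mult[OF G ag]) (use h in simp)
  then show ?thesis using h by (simp add: mult.assoc)
qed

lemma unit_mult_eq_0: "u dvd 1 \<Longrightarrow> c * u = 0 \<Longrightarrow> c = (0::'r::comm_ring_1)"
  by (metis dvdE mult.assoc mult.right_neutral mult_zero_left)

lemma sub_det_identity:
  fixes a :: "('a, 'r::comm_ring_1) lmatrix"
  assumes "finite X" "\<And>x y. x \<in> X \<Longrightarrow> y \<in> X \<Longrightarrow> a x y = (if x = y then 1 else 0)"
  shows "sub_det a X X = 1"
proof -
  let ?xs = "enum_of X"
  have e: "distinct ?xs" "set ?xs = X" using enum_of[OF assms(1)] by auto
  then have "list_submatrix a ?xs ?xs = 1\<^sub>m (length ?xs)"
    using nth_mem[of _ ?xs]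
    by (intro eq_matI) (auto simp: list_submatrix_def assms(2) nth_eq_iff_index_eq)
  then show ?thesis by (simp add: sub_det_def)
qed

text \<open>\<open>a\<close> stands for \<open>[I A]\<close>: \<open>R\<close> labels the rows and
  also the identity columns among the columns \<open>E\<close>.\<close>

locale represented =
  fixes G :: "'r::comm_ring_1 set" and R E :: "'a set" and a :: "('a, 'r) lmatrix"
  assumes G: "partial_field G" and finE: "finite E" and RE: "R \<subseteq> E"
    and minors: "maximal_minors_in G R E a"
    and identity: "\<And>x y. x \<in> R \<Longrightarrow> y \<in> R \<Longrightarrow> a x y = (if x = y then 1 else 0)"
begin

abbreviation "M \<equiv> column_matroid R E a"

lemma finR: "finite R"
  using RE finE by (rule finite_subset)

lemma ground_column_matroid: "ground M = E"
  by (simp add: column_matroid_def)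

lemma basisD:
  assumes "B \<in> bases M"
  shows "B \<subseteq> E" "finite B" "card R = card B" "sub_det a R B \<in> G" "sub_det a R B dvd 1"
proof -
  show 1: "B \<subseteq> E" "card R = card B" using assms by (auto simp: column_matroid_def)
  show "finite B" by (rule finite_subset[OF 1(1) finE])
  show "sub_det a R B \<in> G"
    using assms minors by (auto simp: column_matroid_def maximal_minors_in_def)
  then show "sub_det a R B dvd 1" by (rule partial_field_unit[OF G])
qed

lemma basisI: "B \<subseteq> E \<Longrightarrow> card B = card R \<Longrightarrow> sub_det a R B \<noteq> 0 \<Longrightarrow> B \<in> bases M"
  by (simp add: column_matroid_def)

lemma basis_rows: "R \<in> bases M"
  by (rule basisI) (use RE sub_det_identity[OF finR, of a] identity in auto)

text \<open>By Cramer's rule \<open>c b\<close> is, up to sign, the quotient of the minors at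
  \<open>insert y (B - {b})\<close> and at \<open>B\<close>. The latter is in \<open>G\<close>, so
  the quotient is in \<open>G\<close> or 0, and it is 0 only if the former minor is.\<close>

lemma basis_coefficient:
  assumes B: "B \<in> bases M" and b: "b \<in> B" and y: "y \<in> E - B"
    and comb: "\<And>x. x \<in> R \<Longrightarrow> a x y = (\<Sum>j\<in>B. c j * a x j)"
  shows "c b \<in> insert 0 G" "c b \<noteq> 0 \<Longrightarrow> insert y (B - {b}) \<in> bases M"
proof -
  let ?C = "insert y (B - {b})"
  have ex: "sub_det a R ?C =\<^sub>\<plusminus> c b * sub_det a R B"
    by (rule sub_det_exchange[OF finR basisD(2,3)[OF B] b]) (use y comb in auto)
  have C: "?C \<subseteq> E" "card ?C = card R"
    using y b basisD[OF B] card_Suc_Diff1[of B b] by auto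
  then have "sub_det a R ?C \<in> insert 0 G" using minors by (simp add: maximal_minors_in_def)
  then have "c b * sub_det a R B \<in> insert 0 G"
    by (rule partial_field_eq_upto_sign[OF G eq_upto_sign_sym[OF ex]])
  then show "c b \<in> insert 0 G" by (rule partial_field_cancel[OF G basisD(4)[OF B]])
  assume "c b \<noteq> 0"
  then have "sub_det a R ?C \<noteq> 0"
    using unit_mult_eq_0[OF basisD(5)[OF B]] eq_upto_sign_zero[OF ex] by blast
  then show "?C \<in> bases M" by (rule basisI[OF C])
qed

text \<open>If no exchange for \<open>b\<close> existed, all columns of \<open>B'\<close> would be
  combinations of the \<open>card R - 1\<close> columns in \<open>B - {b}\<close>, and the minor at
  \<open>B'\<close> would vanish.\<close>

lemma matroid_column_matroid: "matroid M"
  unfolding matroid_def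
proof (intro conjI ballI)
  show "finite (ground M)" using finE by (simp add: ground_column_matroid)
  show "bases M \<subseteq> Pow (ground M)" using basisD(1) by (auto simp: ground_column_matroid)
  show "bases M \<noteq> {}" using basis_rows by blast
  fix B B' b assume B: "B \<in> bases M" and B': "B' \<in> bases M" and b: "b \<in> B - B'"
  show "\<exists>y\<in>B' - B. insert y (B - {b}) \<in> bases M"
  proof (rule ccontr)
    assume none: "\<not> (\<exists>y\<in>B' - B. insert y (B - {b}) \<in> bases M)"
    have "\<exists>c. \<forall>x\<in>R. a x y = (\<Sum>j\<in>B - {b}. c j * a x j)" if y: "y \<in> B'" for y
    proof (cases "y \<in> B")
      case True
      then have "y \<in> B - {b}" using y b by auto
      then have "a x y = (\<Sum>j\<in>B - {b}. (if j = y then 1 else 0) * a x j)" for x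
        using basisD(2)[OF B] by (subst sum.mono_neutral_right[of _ "{y}"]) auto
      then show ?thesis by (intro exI[of _ "\<lambda>j. if j = y then 1 else 0"]) blast
    next
      case False
      obtain c where c: "\<And>x. x \<in> R \<Longrightarrow> a x y = (\<Sum>j\<in>B. c j * a x j)"
        using unit_sub_det_spans[OF finR basisD(2,3,5)[OF B], of y] by blast
      \<comment> \<open>A nonzero coefficient at \<open>b\<close> would make \<open>y\<close> an
        admissible replacement for \<open>b\<close>.\<close>
      have "c b = 0"
        using basis_coefficient(2)[OF B _ _ c, of b] none False y b basisD(1)[OF B'] by blast
      then have "(\<Sum>j\<in>B. c j * a x j) = (\<Sum>j\<in>B - {b}. c j * a x j)" for x
        using basisD(2)[OF B] b by (simp add: sum.remove[of B b])
      then show ?thesis using c by (intro exI[of _ c]) simp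
    qed
    then obtain c where c: "\<And>y x. y \<in> B' \<Longrightarrow> x \<in> R \<Longrightarrow> a x y = (\<Sum>j\<in>B - {b}. c y j * a x j)"
      by metis
    have "sub_det a R B' = 0"
    proof (rule sub_det_low_rank[OF finR basisD(2,3)[OF B'] _ _ c])
      show "finite (B - {b})" using basisD(2)[OF B] by simp
      show "card (B - {b}) < card R" using basisD(2,3)[OF B] b card_Diff1_less[of B b] by simp
    qed
    then show False using B' by (simp add: column_matroid_def)
  qed
qed

lemma full_indep_basis:
  assumes "indep M J" "card J = card R" shows "J \<in> bases M"
proof -
  obtain C where C: "C \<in> bases M" "J \<subseteq> C" using assms(1) unfolding indep_def by blast
  then have "J = C" using assms(2) basisD(2,3)[OF C(1)] by (intro card_subset_eq) auto
  then show ?thesis using C by simp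
qed

text \<open>Expand \<open>e\<close> in a basis \<open>C\<close> containing \<open>P\<close>. A
  nonzero coefficient at some \<open>b\<close> outside \<open>P\<close> would give a basis
  \<open>insert e (C - {b})\<close>, making \<open>insert e P\<close> independent.\<close>

lemma span_coefficients:
  assumes P: "indep M P" and e: "e \<in> E" "e \<notin> P" "\<not> indep M (insert e P)"
  obtains c where "\<And>x. x \<in> R \<Longrightarrow> a x e = (\<Sum>p\<in>P. c p * a x p)"
    "\<And>p. p \<in> P \<Longrightarrow> c p \<in> insert 0 G"
proof -
  obtain C where C: "C \<in> bases M" "P \<subseteq> C" using P unfolding indep_def by blast
  have eC: "e \<in> E - C" using e C indep_subset[OF indep_basis[OF C(1)], of "insert e P"] by blast
  obtain c where c: "\<And>x. x \<in> R \<Longrightarrow> a x e = (\<Sum>j\<in>C. c j * a x j)"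
    using unit_sub_det_spans[OF finR basisD(2,3,5)[OF C(1)], of e] by blast
  have "c b = 0" if b: "b \<in> C - P" for b
  proof (rule ccontr)
    assume "c b \<noteq> 0"
    then have "insert e (C - {b}) \<in> bases M" using basis_coefficient(2)[OF C(1) _ eC c] b by blast
    moreover have "insert e P \<subseteq> insert e (C - {b})" using b C by blast
    ultimately show False using e(3) unfolding indep_def by blast
  qed
  then have sum: "(\<Sum>j\<in>C. c j * a x j) = (\<Sum>p\<in>P. c p * a x p)" for x
    using C basisD(2)[OF C(1)] by (intro sum.mono_neutral_right) auto
  show ?thesis
  proof (rule that)
    show "a x e = (\<Sum>p\<in>P. c p * a x p)" if "x \<in> R" for x using c[OF that] sum by simp
    show "c p \<in> insert 0 G" if "p \<in> P" for p
      using basis_coefficient(1)[OF C(1) _ eC c] that C by blast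
  qed
qed

text \<open>\<open>P'\<close> is a maximum independent subset of \<open>P\<close>, and
  \<open>p\<close> is any further element of \<open>P\<close>.\<close>

lemma dependent_column:
  assumes P: "P \<subseteq> E" "\<not> indep M P"
  obtains p P' c where "p \<in> P" "P' \<subseteq> P - {p}" "\<And>x. x \<in> R \<Longrightarrow> a x p = (\<Sum>q\<in>P'. c q * a x q)"
proof -
  note M = matroid_column_matroid
  obtain J where J: "J \<subseteq> P" "indep M J" "card J = rank M P" by (rule rank_witness[OF M])
  have "J \<noteq> P" using J(2) P(2) by auto
  then obtain p where p: "p \<in> P" "p \<notin> J" using J(1) by blast
  have "\<not> indep M (insert p J)"
  proof
    assume "indep M (insert p J)"
    then have "card (insert p J) \<le> rank M P" using J p by (intro card_le_rank[OF M]) auto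
    then show False using J p indep_finite[OF M J(2)] by simp
  qed
  moreover have "p \<in> E" using p P by blast
  ultimately obtain c where c: "\<And>x. x \<in> R \<Longrightarrow> a x p = (\<Sum>q\<in>J. c q * a x q)"
    using span_coefficients[OF J(2)] p(2) by metis
  have "J \<subseteq> P - {p}" using J(1) p(2) by blast
  then show ?thesis using that[OF p(1) _ c] by simp
qed

lemma indep_singleton_nonzero:
  assumes "indep M {e}" obtains x where "x \<in> R" "a x e \<noteq> 0"
proof -
  obtain C where C: "C \<in> bases M" "e \<in> C" using assms unfolding indep_def by blast
  then have "\<exists>x\<in>R. a x e \<noteq> 0"
    using sub_det_zero_column[OF finR basisD(2,3)[OF C(1)] C(2), of a]
    by (auto simp: column_matroid_def)
  then show ?thesis using that by blast
qed

section \<open>Sets of columns on which a block of rows vanishes\<close>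

context
  fixes X' X E' :: "'a set"
  assumes R: "R = X' \<union> X" "X' \<inter> X = {}" and E': "E' \<subseteq> E" "X \<subseteq> E'" "X' \<inter> E' = {}"
    and zero: "\<And>x y. x \<in> X' \<Longrightarrow> y \<in> E' \<Longrightarrow> a x y = 0"
begin

lemma fin_rows: "finite X'" "finite X" "finite E'"
  using finR R finE E' finite_subset by auto

text \<open>A basis through \<open>I\<close> needs at least \<open>card X'\<close> columns outside
  \<open>E'\<close>, since the rows \<open>X'\<close> vanish on \<open>E'\<close>; at most
  \<open>card X\<close> columns are left for \<open>E'\<close>.\<close>

lemma card_indep_zero_block:
  assumes "I \<subseteq> E'" "indep M I" shows "card I \<le> card X"
proof -
  obtain C where C: "C \<in> bases M" "I \<subseteq> C" using assms(2) unfolding indep_def by blast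
  have fC: "finite C" and CE: "C \<subseteq> E" by (rule basisD[OF C(1)])+
  have CC: "C = (C - E') \<union> (C \<inter> E')" by blast
  then have cC: "card C = card (C - E') + card (C \<inter> E')"
    using fC card_Un_disjoint[of "C - E'" "C \<inter> E'"] by auto
  have cR: "card R = card X' + card X" using R fin_rows by (simp add: card_Un_disjoint)
  have "\<not> card (C - E') < card X'"
  proof
    assume "card (C - E') < card X'"
    then have "sub_det a (X' \<union> X) ((C - E') \<union> (C \<inter> E')) = 0"
      using fC fin_rows R zero basisD(3)[OF C(1)] CC by (intro sub_det_deficient_block) auto
    then show False using C(1) R CC by (simp add: column_matroid_def)
  qed
  then have "card (C \<inter> E') \<le> card X" using cC cR basisD(3)[OF C(1)] by simp
  moreover have "card I \<le> card (C \<inter> E')" using assms(1) C fC by (intro card_mono) auto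
  ultimately show ?thesis by simp
qed

text \<open>The identity columns \<open>X\<close> attain the bound. Different choices of
  \<open>X'\<close> give the four ranks needed for gluing.\<close>

lemma rank_zero_block: "rank M E' = card X"
proof (rule antisym)
  show "rank M E' \<le> card X"
    using card_indep_zero_block rank_witness[OF matroid_column_matroid, of E'] by metis
  have "indep M X" using indep_subset[OF indep_basis[OF basis_rows]] R by blast
  then show "card X \<le> rank M E'" using E' by (intro card_le_rank[OF matroid_column_matroid])
qed

text \<open>For \<open>B \<subseteq> E'\<close> of size \<open>card X\<close>, the minor at
  \<open>X' \<union> B\<close> is block triangular with an identity block on \<open>X'\<close>, so
  the bases of the restriction are those \<open>B\<close> that \<open>X'\<close> completes to a
  basis.\<close>

lemma restriction_zero_block:
  assumes n: "\<And>x y. x \<in> X \<Longrightarrow> y \<in> E' \<Longrightarrow> n x y = a x y"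
  shows "restriction M E' = column_matroid X E' n"
proof -
  note M = matroid_column_matroid
  have cR: "card R = card X' + card X" using R fin_rows by (simp add: card_Un_disjoint)
  have fB: "finite B" if "B \<subseteq> E'" for B using that fin_rows finite_subset by blast
  have basis_iff: "X' \<union> B \<in> bases M \<longleftrightarrow> sub_det n X B \<noteq> 0" if B: "B \<subseteq> E'" "card B = card X" for B
  proof -
    have "sub_det a (X' \<union> X) (X' \<union> B) =\<^sub>\<plusminus> sub_det a X' X' * sub_det a X B"
      using fin_rows R fB B E' zero by (intro sub_det_block) auto
    moreover have "sub_det a X' X' = 1"
      using fin_rows identity R by (intro sub_det_identity) auto
    moreover have "sub_det a X B = sub_det n X B"
      using fin_rows fB B n by (intro sub_det_cong) auto
    ultimately have "sub_det a R (X' \<union> B) = 0 \<longleftrightarrow> sub_det n X B = 0"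
      using R eq_upto_sign_zero by auto
    moreover have "X' \<inter> B = {}" using B E' by blast
    then have "X' \<union> B \<subseteq> E \<and> card (X' \<union> B) = card R"
      using B E' R RE fin_rows fB cR by (auto simp: card_Un_disjoint)
    ultimately show ?thesis by (simp add: column_matroid_def)
  qed
  have "B \<subseteq> E' \<and> indep M B \<and> (\<forall>I. indep M I \<and> B \<subseteq> I \<and> I \<subseteq> E' \<longrightarrow> I = B)
      \<longleftrightarrow> B \<subseteq> E' \<and> card B = card X \<and> sub_det n X B \<noteq> 0" for B
  proof (intro iffI conjI; (elim conjE)?)
    assume B: "B \<subseteq> E'" "indep M B" and max: "\<forall>I. indep M I \<and> B \<subseteq> I \<and> I \<subseteq> E' \<longrightarrow> I = B"
    \<comment> \<open>Extending only by elements of \<open>R\<close> forces the part of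
      \<open>J\<close> outside \<open>E'\<close> into \<open>X'\<close>, because
      \<open>X \<subseteq> E'\<close>. Counting then gives all of \<open>X'\<close>.\<close>
    obtain J where J: "B \<subseteq> J" "J \<subseteq> B \<union> R" "indep M J" "card J = rank M (B \<union> R)"
      using indep_extend[OF M B(2), of "B \<union> R"] by blast
    have JB: "J \<inter> E' = B"
      using max indep_subset[OF J(3), of "J \<inter> E'"] J(1) B by blast
    have "card R \<le> card J"
      using J(4) card_le_rank[OF M indep_basis[OF basis_rows], of "B \<union> R"] by simp
    moreover obtain C where C: "C \<in> bases M" "J \<subseteq> C" using J(3) unfolding indep_def by blast
    then have "card J \<le> card R" using basisD(2,3)[OF C(1)] by (simp add: card_mono)
    ultimately have cJ: "card J = card R" by simp
    have fJ: "finite J" by (rule indep_finite[OF M J(3)])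
    have "J = (J - E') \<union> B" using JB by blast
    then have cJ': "card J = card (J - E') + card B"
      using fJ fB[OF B(1)] B(1) card_Un_disjoint[of "J - E'" B] by auto
    have JX: "J - E' \<subseteq> X'" using J(2) B(1) R(1) E'(2) by blast
    then have "card (J - E') \<le> card X'" using fin_rows by (simp add: card_mono)
    moreover have "card B \<le> card X" by (rule card_indep_zero_block[OF B])
    ultimately have c: "card B = card X" "card (J - E') = card X'" using cJ cJ' cR by auto
    show "card B = card X" by (rule c(1))
    have "J - E' = X'" using JX c(2) fin_rows by (intro card_subset_eq) auto
    then have "J = X' \<union> B" using JB by blast
    then have "X' \<union> B \<in> bases M" using full_indep_basis[OF J(3) cJ] by simp
    then show "sub_det n X B \<noteq> 0" using basis_iff[OF B(1) c(1)] by simp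
  next
    assume B: "B \<subseteq> E'" "card B = card X" "sub_det n X B \<noteq> 0"
    then have basis: "X' \<union> B \<in> bases M" using basis_iff by simp
    show "indep M B" by (rule indep_subset[OF indep_basis[OF basis]]) blast
    show "\<forall>I. indep M I \<and> B \<subseteq> I \<and> I \<subseteq> E' \<longrightarrow> I = B"
    proof (intro allI impI; elim conjE)
      fix I assume I: "indep M I" "B \<subseteq> I" "I \<subseteq> E'"
      show "I = B"
        using card_indep_zero_block[OF I(3,1)] I(2) fB[OF I(3)] B(2) card_seteq[of I B] by auto
    qed
  qed
  then show ?thesis unfolding restriction_def column_matroid_def by simp
qed

end

end

section \<open>Gluing along a modular flat\<close>

text \<open>Strong induction on \<open>card (B - E2)\<close>: every exchange brings a column into
  \<open>E2\<close>, and once the count is down to \<open>card X1\<close> the minor is block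
  triangular.\<close>

lemma maximal_minors_glue:
  fixes a a1 a2 :: "('a, 'r::comm_ring_1) lmatrix"
  assumes rep1: "represented G (X1 \<union> X) E1 a1"
    and minors2: "maximal_minors_in G (X \<union> X2) E2 a2"
    and fin2: "finite E2" "X2 \<subseteq> E2"
    and disj: "X1 \<inter> X = {}" "X1 \<inter> E2 = {}" "X2 \<inter> E1 = {}" and XE2: "X \<subseteq> E2"
    and a1: "\<And>x y. x \<in> X1 \<union> X \<Longrightarrow> y \<in> E1 \<Longrightarrow> a x y = a1 x y"
    and a2: "\<And>x y. x \<in> X \<union> X2 \<Longrightarrow> y \<in> E2 \<Longrightarrow> a x y = a2 x y"
    and zero1: "\<And>x y. x \<in> X1 \<Longrightarrow> y \<in> E2 \<Longrightarrow> a x y = 0"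
    and zero2: "\<And>x y. x \<in> X2 \<Longrightarrow> y \<in> E1 \<Longrightarrow> a x y = 0"
    and modular: "modular_flat (column_matroid (X1 \<union> X) E1 a1) (E1 \<inter> E2)"
  shows "maximal_minors_in G (X1 \<union> X \<union> X2) (E1 \<union> E2) a"
proof -
  interpret m1: represented G "X1 \<union> X" E1 a1 by (rule rep1)
  let ?R = "X1 \<union> X \<union> X2"
  note G = m1.G and M1 = m1.matroid_column_matroid
  have XE1: "X1 \<subseteq> E1" "X \<subseteq> E1" using m1.RE by auto
  have fin: "finite X1" "finite X" "finite X2"
    using m1.finR finite_subset[OF fin2(2,1)] by auto
  have disjX2: "X2 \<inter> (X1 \<union> X) = {}" using disj XE1 by blast
  have R: "?R = X1 \<union> (X \<union> X2)" "X1 \<inter> (X \<union> X2) = {}" using disj disjX2 by auto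
  have cR: "card ?R = card X1 + card (X \<union> X2)"
    unfolding R(1) using fin R(2) by (simp add: card_Un_disjoint)
  \<comment> \<open>Relations among columns of \<open>a1\<close> persist in \<open>a\<close>, whose
    additional rows \<open>X2\<close> vanish on \<open>E1\<close>.\<close>
  have lift: "a x e = (\<Sum>p\<in>P. c p * a x p)"
    if "P \<subseteq> E1" "e \<in> E1" "\<And>x. x \<in> X1 \<union> X \<Longrightarrow> a1 x e = (\<Sum>p\<in>P. c p * a1 x p)" "x \<in> ?R" for P e c x
  proof (cases "x \<in> X2")
    case True
    then have "a x y = 0" if "y \<in> E1" for y using zero2 that by blast
    moreover from this have "(\<Sum>p\<in>P. c p * a x p) = 0"
      using that(1) by (intro sum.neutral) auto
    ultimately show ?thesis using that(2) by simp
  next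
    case False
    then have x: "x \<in> X1 \<union> X" using that by blast
    have "(\<Sum>p\<in>P. c p * a x p) = (\<Sum>p\<in>P. c p * a1 x p)"
      using that(1) a1[OF x] by (intro sum.cong) auto
    then show ?thesis using that(2,3) a1[OF x] x by simp
  qed
  have "sub_det a ?R B \<in> insert 0 G" if "B \<subseteq> E1 \<union> E2" "card B = card ?R" for B
    using that
  proof (induction "card (B - E2)" arbitrary: B rule: less_induct)
    case less
    let ?P = "B - E2" and ?Q = "B \<inter> E2"
    have fB: "finite B" using less.prems(1) m1.finE fin2 finite_subset by auto
    have P: "?P \<subseteq> E1" using less.prems by blast
    have B: "B = ?P \<union> ?Q" "?P \<inter> ?Q = {}" by auto
    then have cB: "card B = card ?P + card ?Q" using fB card_Un_disjoint[of ?P ?Q] by auto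
    consider "card ?P < card X1" | "card ?P = card X1" | "card X1 < card ?P" "\<not> indep m1.M ?P"
      | "card X1 < card ?P" "indep m1.M ?P" by linarith
    then show ?case
    proof cases
      case 1
      \<comment> \<open>The rows \<open>X1\<close> vanish on \<open>?Q\<close>, and
        \<open>?P\<close> is too small to support them.\<close>
      have "sub_det a (X1 \<union> (X \<union> X2)) (?P \<union> ?Q) = 0"
      proof (rule sub_det_deficient_block)
        show "card (X1 \<union> (X \<union> X2)) = card (?P \<union> ?Q)"
          using less.prems(2) R(1) B(1) by simp
      qed (use fin fB R 1 zero1 in auto)
      then show ?thesis using R(1) B(1) by simp
    next
      case 2
      have cQ: "card (X \<union> X2) = card ?Q" using 2 cB cR less.prems(2) by simp
      have "sub_det a (X1 \<union> (X \<union> X2)) (?P \<union> ?Q) =\<^sub>\<plusminus> sub_det a X1 ?P * sub_det a (X \<union> X2) ?Q"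
        by (rule sub_det_block) (use fin fB R 2 cQ zero1 in auto)
      moreover have "sub_det a (X \<union> X2) ?Q = sub_det a2 (X \<union> X2) ?Q"
        by (rule sub_det_cong) (use fin fB cQ a2 in auto)
      moreover have "sub_det a2 (X \<union> X2) ?Q \<in> insert 0 G"
        using minors2 cQ unfolding maximal_minors_in_def by auto
      moreover have "sub_det a X1 ?P = sub_det a1 X1 ?P"
        by (rule sub_det_cong) (use fin fB 2 a1 P in auto)
      \<comment> \<open>This minor of \<open>a1\<close> is not maximal; adding the identity columns
        \<open>X\<close> completes it to one with the same value up to sign.\<close>
      moreover have "sub_det a1 X1 ?P \<in> insert 0 G"
      proof -
        have PX: "?P \<inter> X = {}" using XE2 by blast
        have "sub_det a1 (X1 \<union> X) (?P \<union> X) =\<^sub>\<plusminus> sub_det a1 X1 ?P * sub_det a1 X X"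
          by (rule sub_det_block) (use fin fB 2 disj PX m1.identity in auto)
        moreover have "sub_det a1 X X = 1"
          by (rule sub_det_identity) (use fin m1.identity in auto)
        moreover have "sub_det a1 (X1 \<union> X) (?P \<union> X) \<in> insert 0 G"
        proof -
          have "?P \<union> X \<subseteq> E1" using P XE1 by blast
          moreover have "card (?P \<union> X) = card (X1 \<union> X)"
            using PX fB fin disj 2 by (simp add: card_Un_disjoint)
          ultimately show ?thesis using m1.minors unfolding maximal_minors_in_def by blast
        qed
        ultimately show ?thesis using partial_field_eq_upto_sign[OF G eq_upto_sign_sym] by simp
      qed
      ultimately have "sub_det a (X1 \<union> (X \<union> X2)) (?P \<union> ?Q) \<in> insert 0 G"
        using partial_field_eq_upto_sign[OF G] partial_field_mult[OF G] by simp
      then show ?thesis using R(1) B(1) by simp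
    next
      case 3
      obtain p P' c where p: "p \<in> ?P" "P' \<subseteq> ?P - {p}"
        and c: "\<And>x. x \<in> X1 \<union> X \<Longrightarrow> a1 x p = (\<Sum>q\<in>P'. c q * a1 x q)"
        using m1.dependent_column[OF P 3(2)] by blast
      have "sub_det a ?R B = 0"
      proof (rule sub_det_dependent_column[where P = P' and y = p and c = c])
        show "a x p = (\<Sum>q\<in>P'. c q * a x q)" if "x \<in> ?R" for x
          by (rule lift[OF _ _ c that]) (use p P in auto)
      qed (use fin fB p less.prems in auto)
      then show ?thesis by simp
    next
      case 4
      let ?T = "E1 \<inter> E2" and ?F = "closure m1.M ?P"
      have flatF: "flat m1.M ?F" by (rule flat_closure[OF M1]) (use P m1.ground_column_matroid in simp)
      have "rank m1.M ?F = card ?P"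
        using rank_closure[OF M1, of ?P] rank_indep[OF M1 4(2)] P m1.ground_column_matroid by simp
      moreover have "card X \<le> rank m1.M ?T"
      proof (rule card_le_rank[OF M1])
        show "indep m1.M X" by (rule indep_subset[OF indep_basis[OF m1.basis_rows]]) simp
      qed (use XE1 XE2 in simp)
      moreover have "rank m1.M (?T \<union> ?F) \<le> card (X1 \<union> X)"
      proof -
        obtain I where I: "indep m1.M I" "card I = rank m1.M (?T \<union> ?F)"
          by (rule rank_witness[OF M1])
        obtain C where "C \<in> bases m1.M" "I \<subseteq> C" using I(1) unfolding indep_def by blast
        then have "card I \<le> card (X1 \<union> X)" using m1.basisD(2,3) by (metis card_mono)
        then show ?thesis using I by simp
      qed
      moreover have "card (X1 \<union> X) = card X1 + card X"
        using fin disj by (simp add: card_Un_disjoint)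
      moreover have "rank m1.M ?T + rank m1.M ?F = rank m1.M (?T \<union> ?F) + rank m1.M (?T \<inter> ?F)"
        using modular flatF unfolding modular_flat_def by blast
      \<comment> \<open>Write \<open>r\<close> for the rank in \<open>m1.M\<close>. From
        \<open>r ?F = card ?P > card X1\<close>, \<open>r ?T \<ge> card X\<close> and
        \<open>r (?T \<union> ?F) \<le> card X1 + card X\<close>, modularity leaves positive rank
        for the intersection.\<close>
      ultimately have "0 < rank m1.M (?T \<inter> ?F)" using 4(1) by linarith
      moreover obtain I where I: "I \<subseteq> ?T \<inter> ?F" "indep m1.M I" "card I = rank m1.M (?T \<inter> ?F)"
        by (rule rank_witness[OF M1])
      ultimately have "I \<noteq> {}" by auto
      then obtain e where "e \<in> I" by blast
      then have e: "e \<in> E1" "e \<in> E2" "e \<in> ?F" "indep m1.M {e}"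
        using I indep_subset[OF I(2), of "{e}"] by auto
      then have eP: "e \<notin> ?P" by blast
      obtain c where c: "\<And>x. x \<in> X1 \<union> X \<Longrightarrow> a1 x e = (\<Sum>p\<in>?P. c p * a1 x p)"
        and cG: "\<And>p. p \<in> ?P \<Longrightarrow> c p \<in> insert 0 G"
        using m1.span_coefficients[OF 4(2) e(1) eP in_closure_indep[OF M1 4(2) e(3) eP]] by metis
      have ca: "a x e = (\<Sum>p\<in>?P. c p * a x p)" if "x \<in> ?R" for x
        by (rule lift[OF P e(1) c that])
      show ?thesis
      proof (cases "e \<in> B")
        case True
        have "sub_det a ?R B = 0"
          by (rule sub_det_dependent_column[where P = ?P and y = e and c = c])
            (use fin fB less.prems True eP ca in auto)
        then show ?thesis by simp
      next
        case False
        obtain x where x: "x \<in> X1 \<union> X" "a1 x e \<noteq> 0"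
          by (rule m1.indep_singleton_nonzero[OF e(4)])
        \<comment> \<open>The column \<open>e\<close> of \<open>a1\<close> is nonzero, so some
          column of \<open>?P\<close> really enters its expansion and can be traded for
          \<open>e\<close>.\<close>
        have "\<exists>p\<in>?P. c p \<noteq> 0"
        proof (rule ccontr)
          assume "\<not> (\<exists>p\<in>?P. c p \<noteq> 0)"
          then have "(\<Sum>p\<in>?P. c p * a1 x p) = 0" by (intro sum.neutral) auto
          then show False using c[OF x(1)] x(2) by simp
        qed
        then obtain p where p: "p \<in> ?P" "c p \<noteq> 0" by blast
        let ?c = "\<lambda>j. if j \<in> ?P then c j else 0"
        have sum: "(\<Sum>p\<in>?P. c p * a x p) = (\<Sum>j\<in>B. ?c j * a x j)" for x
          by (rule sum.mono_neutral_cong_left) (use fB in auto)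
        let ?B = "insert e (B - {p})"
        have ex: "sub_det a ?R ?B =\<^sub>\<plusminus> ?c p * sub_det a ?R B"
        proof (rule sub_det_exchange)
          show "a x e = (\<Sum>j\<in>B. ?c j * a x j)" if "x \<in> ?R" for x
            using ca[OF that] sum by simp
        qed (use fin fB less.prems p False in auto)
        have "sub_det a ?R ?B \<in> insert 0 G"
        proof (rule less.hyps)
          have "?B - E2 = ?P - {p}" using e(2) by blast
          then show "card (?B - E2) < card ?P" using p fB card_Diff1_less[of ?P p] by simp
          show "?B \<subseteq> E1 \<union> E2" using less.prems e by blast
          show "card ?B = card ?R"
            using less.prems(2) False p fB card_Suc_Diff1[of B p] by simp
        qed
        then have "?c p * sub_det a ?R B \<in> insert 0 G"
          by (rule partial_field_eq_upto_sign[OF G eq_upto_sign_sym[OF ex]])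
        then have "sub_det a ?R B * c p \<in> insert 0 G" using p by (simp add: mult.commute)
        moreover have "c p \<in> G" using cG[OF p(1)] p(2) by simp
        ultimately show ?thesis using partial_field_cancel[OF G] by blast
      qed
    qed
  qed
  then show ?thesis unfolding maximal_minors_in_def by blast
qed

text \<open>\<open>flat_glue\<close> shows that \<open>M\<close> has the prescribed flats, and
  \<open>matroid_eqI_flats\<close> supplies the uniqueness that \<open>THE\<close> requires.\<close>

lemma generalized_parallel_connection_eqI:
  assumes M: "matroid M" and M12: "matroid M1" "matroid M2"
    and ground: "ground M = ground M1 \<union> ground M2"
    and restr: "restriction M (ground M1) = M1" "restriction M (ground M2) = M2"
    and N: "restriction M1 (ground M1 \<inter> ground M2) = N" "restriction M2 (ground M1 \<inter> ground M2) = N"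
    and modular: "modular_flat M1 (ground M1 \<inter> ground M2)"
    and rank: "rank M (ground M1 \<union> ground M2) + rank M (ground M1 \<inter> ground M2)
             = rank M (ground M1) + rank M (ground M2)"
  shows "gpc_admissible N M1 M2 \<and> generalized_parallel_connection N M1 M2 = M"
proof
  show adm: "gpc_admissible N M1 M2" unfolding gpc_admissible_def using M12 N modular by blast
  have fl: "flat M F \<longleftrightarrow> flat M1 (F \<inter> ground M1) \<and> flat M2 (F \<inter> ground M2)" if "F \<subseteq> ground M" for F
    using flat_glue[OF M ground _ rank, of F] modular restr that ground by simp
  show "generalized_parallel_connection N M1 M2 = M"
    unfolding generalized_parallel_connection_def
  proof (rule the_equality)
    fix K :: "'a set_system"
    assume K: "gpc_admissible N M1 M2 \<and> matroid K \<and> ground K = ground M1 \<union> ground M2 \<and>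
      (\<forall>F\<subseteq>ground K. flat K F \<longleftrightarrow> flat M1 (F \<inter> ground M1) \<and> flat M2 (F \<inter> ground M2))"
    show "K = M" by (rule matroid_eqI_flats) (use K M ground fl in auto)
  qed (use adm M ground fl in auto)
qed

section \<open>From submatrices of \<open>A\<close> to maximal minors of
  \<open>[I A]\<close>\<close>

lemma matroid_of_eq_column_matroid: "matroid_of X Y A = column_matroid X (X \<union> Y) (prepend_identity X A)"
  by (simp add: matroid_of_def column_matroid_def)

text \<open>Identity columns for the rows outside \<open>S\<close> complete \<open>T\<close> to a
  maximal column set; they vanish on the rows \<open>S\<close>, and their own block has determinant
  1.\<close>

lemma sub_det_prepend_identity:
  fixes A :: "('a, 'r::comm_ring_1) lmatrix"
  assumes fin: "finite X" "finite Y" and disj: "X \<inter> Y = {}"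
    and S: "S \<subseteq> X" and T: "T \<subseteq> Y" and card: "card S = card T"
  shows "sub_det (prepend_identity X A) X (T \<union> (X - S)) =\<^sub>\<plusminus> sub_det A S T"
proof -
  let ?a = "prepend_identity X A"
  have f: "finite S" "finite T" using fin S T finite_subset by auto
  have "sub_det ?a (S \<union> (X - S)) (T \<union> (X - S)) =\<^sub>\<plusminus> sub_det ?a S T * sub_det ?a (X - S) (X - S)"
    by (rule sub_det_block) (use fin f S T card disj in \<open>auto simp: prepend_identity_def col_split_def\<close>)
  moreover have "sub_det ?a (X - S) (X - S) = 1"
    by (rule sub_det_identity) (use fin in \<open>auto simp: prepend_identity_def col_split_def\<close>)
  moreover have "sub_det ?a S T = sub_det A S T"
    by (rule sub_det_cong) (use f T disj card in \<open>auto simp: prepend_identity_def col_split_def\<close>)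
  moreover have "S \<union> (X - S) = X" using S by blast
  ultimately show ?thesis by simp
qed

lemma P_matrix_iff_maximal_minors:
  fixes A :: "('a, 'r::comm_ring_1) lmatrix"
  assumes G: "partial_field G" and fin: "finite X" "finite Y" and disj: "X \<inter> Y = {}"
  shows "P_matrix G X Y A \<longleftrightarrow> maximal_minors_in G X (X \<union> Y) (prepend_identity X A)"
proof
  assume A: "P_matrix G X Y A"
  show "maximal_minors_in G X (X \<union> Y) (prepend_identity X A)"
    unfolding maximal_minors_in_def
  proof (intro allI impI)
    fix B assume B: "B \<subseteq> X \<union> Y" "card B = card X"
    \<comment> \<open>Inverts the passage from \<open>S\<close>, \<open>T\<close> to
      \<open>T \<union> (X - S)\<close>: every column set of full size arises in this way.\<close>
    let ?S = "X - B" and ?T = "B - X"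
    have fB: "finite B" using B(1) fin finite_subset by blast
    have "card B = card ?T + card (B \<inter> X)" "card X = card ?S + card (X \<inter> B)"
      using fB fin by (metis card_Diff_subset_Int card_mono finite_Int inf_le1 le_add_diff_inverse2)+
    then have card: "card ?S = card ?T" using B(2) by (simp add: Int_commute)
    have T: "?T \<subseteq> Y" using B by blast
    have "sub_det A ?S ?T \<in> insert 0 G"
      using A card T unfolding P_matrix_def by auto
    moreover have "sub_det (prepend_identity X A) X (?T \<union> (X - ?S)) =\<^sub>\<plusminus> sub_det A ?S ?T"
      by (rule sub_det_prepend_identity[OF fin disj _ T card]) blast
    ultimately have "sub_det (prepend_identity X A) X (?T \<union> (X - ?S)) \<in> insert 0 G"
      using partial_field_eq_upto_sign[OF G] by blast
    moreover have "?T \<union> (X - ?S) = B" by blast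
    ultimately show "sub_det (prepend_identity X A) X B \<in> insert 0 G" by simp
  qed
next
  assume a: "maximal_minors_in G X (X \<union> Y) (prepend_identity X A)"
  show "P_matrix G X Y A"
    unfolding P_matrix_def
  proof (intro allI impI; elim conjE)
    fix S T assume S: "S \<subseteq> X" and T: "T \<subseteq> Y" and card: "card S = card T"
    have f: "finite S" "finite T" using fin S T finite_subset by auto
    have "card (T \<union> (X - S)) = card T + card (X - S)"
      using f fin disj T by (intro card_Un_disjoint) auto
    also have "\<dots> = card X" using card S fin f card_mono[OF fin(1) S] by (simp add: card_Diff_subset)
    finally have "card (T \<union> (X - S)) = card X" .
    moreover have "T \<union> (X - S) \<subseteq> X \<union> Y" using T by blast
    ultimately have "sub_det (prepend_identity X A) X (T \<union> (X - S)) \<in> insert 0 G"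
      using a unfolding maximal_minors_in_def by simp
    then have "sub_det A S T \<in> insert 0 G"
      by (rule partial_field_eq_upto_sign[OF G eq_upto_sign_sym[OF sub_det_prepend_identity[OF fin disj S T card]]])
    then show "sub_det A S T = 0 \<or> sub_det A S T \<in> G" by simp
  qed
qed

lemma represented_prepend_identity:
  assumes "partial_field G" "finite X" "finite Y" "X \<inter> Y = {}" "P_matrix G X Y A"
  shows "represented G X (X \<union> Y) (prepend_identity X A)"
  by (rule represented.intro)
    (use assms P_matrix_iff_maximal_minors[OF assms(1-4)] in \<open>auto simp: prepend_identity_def col_split_def\<close>)

text \<open>The conjunct \<open>gpc_admissible\<close> ensures that the final equation does not
  concern an unspecified value of \<open>generalized_parallel_connection\<close>.\<close>

theorem theorem3p1:
  fixes G :: "'r::comm_ring_1 set"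
    and X Y X1 Y1 X2 Y2 :: "'a set"
    and D1' D1 DX D2 D2' A1 A2 A :: "'a \<Rightarrow> 'a \<Rightarrow> 'r"
    and M1 M2 N :: "'a set_system"
  assumes "partial_field G"
    and "finite X" "finite Y" "finite X1" "finite Y1" "finite X2" "finite Y2"
    and "X \<inter> Y = {}" "X \<inter> X1 = {}" "X \<inter> Y1 = {}" "X \<inter> X2 = {}" "X \<inter> Y2 = {}"
    and "Y \<inter> X1 = {}" "Y \<inter> Y1 = {}" "Y \<inter> X2 = {}" "Y \<inter> Y2 = {}"
    and "X1 \<inter> Y1 = {}" "X1 \<inter> X2 = {}" "X1 \<inter> Y2 = {}"
    and "Y1 \<inter> X2 = {}" "Y1 \<inter> Y2 = {}" "X2 \<inter> Y2 = {}"
    and "A1 = row_split X1 (col_split Y1 D1' zero_lmat)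
                           (col_split Y1 D1  DX)"
    and "A2 = row_split X  (col_split Y DX        D2)
                           (col_split Y zero_lmat D2')"
    and "A = row_split X1 (col_split Y1 D1' zero_lmat)
            (row_split X  (col_split Y1 D1        (col_split Y DX D2))
                          (col_split Y1 zero_lmat (col_split Y zero_lmat D2')))"
    and "P_matrix G (X1 \<union> X) (Y1 \<union> Y) A1"
    and "P_matrix G (X \<union> X2) (Y \<union> Y2) A2"
    and "M1 = matroid_of (X1 \<union> X) (Y1 \<union> Y) A1"
    and "M2 = matroid_of (X \<union> X2) (Y \<union> Y2) A2"
    and "N = matroid_of X Y DX"
    and "modular_flat M1 (X \<union> Y)"
  shows "P_matrix G (X1 \<union> X \<union> X2) (Y1 \<union> Y \<union> Y2) A \<and>
         gpc_admissible N M1 M2 \<and>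
         matroid_of (X1 \<union> X \<union> X2) (Y1 \<union> Y \<union> Y2) A = generalized_parallel_connection N M1 M2"
proof -
  let ?R1 = "X1 \<union> X" and ?R2 = "X \<union> X2" and ?R = "X1 \<union> X \<union> X2"
  let ?C1 = "Y1 \<union> Y" and ?C2 = "Y \<union> Y2" and ?C = "Y1 \<union> Y \<union> Y2"
  let ?E1 = "?R1 \<union> ?C1" and ?E2 = "?R2 \<union> ?C2" and ?E = "?R \<union> ?C" and ?T = "X \<union> Y"
  let ?a1 = "prepend_identity ?R1 A1" and ?a2 = "prepend_identity ?R2 A2" and ?a = "prepend_identity ?R A"
    and ?n = "prepend_identity X DX"
  note G = assms(1) and fin = assms(2-7) and disj = assms(8-22)
  note A = assms(23-25) and P = assms(26,27) and Ms = assms(28-30)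
  note entries = A prepend_identity_def row_split_def col_split_def zero_lmat_def
  have T: "?E1 \<inter> ?E2 = ?T" and E: "?E1 \<union> ?E2 = ?E" using disj by auto
  have M: "M1 = column_matroid ?R1 ?E1 ?a1" "M2 = column_matroid ?R2 ?E2 ?a2"
    "N = column_matroid X ?T ?n" using Ms matroid_of_eq_column_matroid by auto
  have mod: "modular_flat (column_matroid ?R1 ?E1 ?a1) (?E1 \<inter> ?E2)"
    using assms(31) M(1) T by simp
  have rep1: "represented G ?R1 ?E1 ?a1"
    by (rule represented_prepend_identity) (use G fin disj P in auto)
  have rep2: "represented G ?R2 ?E2 ?a2"
    by (rule represented_prepend_identity) (use G fin disj P in auto)
  interpret m1: represented G ?R1 ?E1 ?a1 by (rule rep1)
  interpret m2: represented G ?R2 ?E2 ?a2 by (rule rep2)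
  have a1: "?a x y = ?a1 x y" if "x \<in> ?R1" "y \<in> ?E1" for x y
    using that disj by (auto simp: entries)
  have a2: "?a x y = ?a2 x y" if "x \<in> ?R2" "y \<in> ?E2" for x y
    using that disj by (auto simp: entries)
  have zero1: "?a x y = 0" if "x \<in> X1" "y \<in> ?E2" for x y
    using that disj by (auto simp: entries)
  have zero2: "?a x y = 0" if "x \<in> X2" "y \<in> ?E1" for x y
    using that disj by (auto simp: entries)
  have n1: "?n x y = ?a1 x y" if "x \<in> X" "y \<in> ?T" for x y
    using that disj by (auto simp: entries)
  have n2: "?n x y = ?a2 x y" if "x \<in> X" "y \<in> ?T" for x y
    using that disj by (auto simp: entries)
  have zero1T: "?a1 x y = 0" if "x \<in> X1" "y \<in> ?T" for x y
    using that disj by (auto simp: entries)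
  have zero2T: "?a2 x y = 0" if "x \<in> X2" "y \<in> ?T" for x y
    using that disj by (auto simp: entries)
  have "maximal_minors_in G ?R (?E1 \<union> ?E2) ?a"
    by (rule maximal_minors_glue[OF rep1 m2.minors _ _ _ _ _ _ a1 a2 zero1 zero2 mod])
      (use fin disj in auto)
  then have PA: "P_matrix G ?R ?C A"
    unfolding E by (subst P_matrix_iff_maximal_minors) (use G fin disj in auto)
  \<comment> \<open>Only now is \<open>A\<close> known to be a \<open>P\<close>-matrix, so that its
    columns define a matroid.\<close>
  interpret m: represented G ?R ?E ?a
    by (rule represented_prepend_identity) (use G fin disj PA in auto)
  have r1: "restriction m.M ?E1 = m1.M"
    by (rule m.restriction_zero_block[of X2]) (use disj zero2 a1 in auto)
  have r2: "restriction m.M ?E2 = m2.M"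
    by (rule m.restriction_zero_block[of X1]) (use disj zero1 a2 in auto)
  have N1: "restriction m1.M ?T = N"
    unfolding M(3) by (rule m1.restriction_zero_block[of X1]) (use disj zero1T n1 in auto)
  have N2: "restriction m2.M ?T = N"
    unfolding M(3) by (rule m2.restriction_zero_block[of X2]) (use disj zero2T n2 in auto)
  have rank1: "rank m.M ?E1 = card ?R1"
    by (rule m.rank_zero_block[of X2]) (use disj zero2 in auto)
  have rank2: "rank m.M ?E2 = card ?R2"
    by (rule m.rank_zero_block[of X1]) (use disj zero1 in auto)
  \<comment> \<open>On \<open>?T\<close> the rows of both \<open>X1\<close> and \<open>X2\<close>
    vanish, leaving just those of \<open>X\<close>.\<close>
  have rankT: "rank m.M ?T = card X"
    by (rule m.rank_zero_block[of "X1 \<union> X2"]) (use disj zero1 zero2 in auto)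
  have rankE: "rank m.M ?E = card ?R"
    by (rule m.rank_zero_block[of "{}"]) auto
  \<comment> \<open>With the four ranks above, this count of rows is the rank equation required for
    gluing.\<close>
  have "card ?R + card X = card ?R1 + card ?R2"
  proof -
    have "card ?R = card ?R1 + card X2" using fin disj by (intro card_Un_disjoint) auto
    moreover have "card ?R2 = card X + card X2" using fin disj by (intro card_Un_disjoint) auto
    ultimately show ?thesis by simp
  qed
  then have "gpc_admissible N m1.M m2.M \<and> generalized_parallel_connection N m1.M m2.M = m.M"
    using m.matroid_column_matroid m1.matroid_column_matroid m2.matroid_column_matroid
      r1 r2 N1 N2 mod rank1 rank2 rankT rankE
    by (intro generalized_parallel_connection_eqI)
      (simp_all only: m.ground_column_matroid m1.ground_column_matroid m2.ground_column_matroid T E)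
  then show ?thesis using PA M(1,2) matroid_of_eq_column_matroid[of ?R ?C A] by simp
qed

end
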